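(* Let $n\ge 1$, let $\mathbf{X}$ be any random vector in $\mathbb{R}^n$, let $0<\mathsf{snr}\le \mathsf{snr}_0$, and suppose $\mathrm{mmse}(\mathbf{X},\mathsf{snr}_0)=\frac{\beta}{1+\beta\,\mathsf{snr}_0}$ for some $\beta\in[0,1]$. Then $$\mathrm{mmse}(\mathbf{X},\mathsf{snr})\le \mathrm{mmse}(\mathbf{X},\mathsf{snr}_0)+k_n\left(\frac{1}{\mathsf{snr}}-\frac{1}{\mathsf{snr}_0}\right)-\Delta,\qquad k_n= n+2,$$ with $\Delta=0$. If in addition $\frac1n \mathrm{Tr}\left(\mathbb{E}[\mathbf{X}\mathbf{X}^{T}]\right)\le 1$, then the same inequality holds with $$\Delta=\int_{\mathsf{snr}}^{\mathsf{snr}_0}\frac{1}{\gamma^2(1+\gamma)^2}\,d\gamma =2\log\left(\frac{1+\mathsf{snr}_0}{1+\mathsf{snr}}\right)-2\log\left(\frac{\mathsf{snr}_0}{\mathsf{snr}}\right)+\frac{1}{1+\mathsf{snr}}-\frac{1}{1+\mathsf{snr}_0}+\frac{1}{\mathsf{snr}}-\frac{1}{\mathsf{snr}_0}.$$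
   Context: For a random vector $\mathbf{X}\in\mathbb{R}^n$ and $\mathsf{snr}\ge 0$, let $\mathbf{Y}=\mathbf{Y}_{\mathsf{snr}}=\sqrt{\mathsf{snr}}\,\mathbf{X}+\mathbf{Z}$, where $\mathbf{Z}\sim\mathcal{N}(\mathbf{0},\mathbf{I})$ is a standard Gaussian vector in $\mathbb{R}^n$ independent of $\mathbf{X}$. Define the conditional covariance $\mathbf{Cov}(\mathbf{X}|\mathbf{Y})=\mathbb{E}\left[(\mathbf{X}-\mathbb{E}[\mathbf{X}|\mathbf{Y}])(\mathbf{X}-\mathbb{E}[\mathbf{X}|\mathbf{Y}])^{T}\,|\,\mathbf{Y}\right]$ and the minimum mean square error $\mathrm{mmse}(\mathbf{X},\mathsf{snr})=\frac1n\mathrm{Tr}\left(\mathbb{E}[\mathbf{Cov}(\mathbf{X}|\mathbf{Y})]\right)$. Logarithms are natural. *)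

theory Defs
  imports "HOL-Probability.Probability"
begin

text \<open>Random vectors in n-space are measurable functions into \<^typ>\<open>real ^ 'n\<close>, n being \<open>CARD('n)\<close>.\<close>

text \<open>The matrix v v^T. The type constraint makes the inner dimension 1, which is otherwise
  left open by \<^const>\<open>columnvector\<close> and \<^const>\<open>rowvector\<close>.\<close>
definition outer :: "real ^ 'n \<Rightarrow> real ^ 'n ^ 'n" where
  "outer v = (columnvector v :: real ^ 1 ^ 'n) ** (rowvector v :: real ^ 'n ^ 1)"

definition std_gaussian_density :: "real ^ 'n \<Rightarrow> real" where
  "std_gaussian_density z = (\<Prod>i\<in>UNIV. std_normal_density (z $ i))"

definition awgn :: "('a \<Rightarrow> real ^ 'n) \<Rightarrow> ('a \<Rightarrow> real ^ 'n) \<Rightarrow> real \<Rightarrow> 'a \<Rightarrow> real ^ 'n" where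
  "awgn X Z snr = (\<lambda>\<omega>. sqrt snr *\<^sub>R X \<omega> + Z \<omega>)"

text \<open>Conditional expectations given Y are conditional expectations with respect to the
  sigma-algebra generated by Y, taken entrywise.  \<^const>\<open>real_cond_exp\<close> is the difference of the
  conditional expectations of the positive and the negative part, so it is the usual generalised
  conditional expectation also for a non-integrable argument, provided both parts are almost surely
  finite.  For Y = \<open>awgn X Z snr\<close> with snr > 0 this is the case for every X, whether or not X has
  any moments.\<close>
definition cond_mean ::
  "'a measure \<Rightarrow> ('a \<Rightarrow> real ^ 'n) \<Rightarrow> ('a \<Rightarrow> real ^ 'n) \<Rightarrow> 'a \<Rightarrow> real ^ 'n" where
  "cond_mean M X Y =
    (\<lambda>\<omega>. \<chi> i. real_cond_exp M (vimage_algebra (space M) Y borel) (\<lambda>\<omega>'. X \<omega>' $ i) \<omega>)"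

definition cond_cov ::
  "'a measure \<Rightarrow> ('a \<Rightarrow> real ^ 'n) \<Rightarrow> ('a \<Rightarrow> real ^ 'n) \<Rightarrow> 'a \<Rightarrow> real ^ 'n ^ 'n" where
  "cond_cov M X Y =
    (\<lambda>\<omega>. \<chi> i j. real_cond_exp M (vimage_algebra (space M) Y borel)
                 (\<lambda>\<omega>'. outer (X \<omega>' - cond_mean M X Y \<omega>') $ i $ j) \<omega>)"

text \<open>Only meaningful for snr > 0 unless X is square integrable: for snr > 0 the conditional
  covariance is integrable for every X (its mean trace is at most n / snr), so the Bochner
  integral below does not hide an infinite value.\<close>
definition mmse ::
  "'a measure \<Rightarrow> ('a \<Rightarrow> real ^ 'n) \<Rightarrow> ('a \<Rightarrow> real ^ 'n) \<Rightarrow> real \<Rightarrow> real" where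
  "mmse M X Z snr =
    trace (integral\<^sup>L M (cond_cov M X (awgn X Z snr))) / real CARD('n)"

end

theory Submission
  imports Defs
begin

text \<open>Write \<open>\<gamma>\<close> for the signal-to-noise ratio, \<open>u = 1 / \<gamma>\<close>, \<open>m = E[Z | Y]\<close> and \<open>V = Z - m\<close>. As
  \<open>Y = sqrt \<gamma> X + Z\<close>, the estimation error of X is \<open>- V / sqrt \<gamma>\<close>, so n mmse is \<open>F = u E\<bar>V\<bar>\<^sup>2\<close>.

  To bound F at a slightly smaller ratio \<open>\<gamma>' = \<gamma> / (1 + \<delta>)\<close>, use there the estimator that is optimal
  at \<open>\<gamma>\<close>, rescaled so that it sees \<open>sqrt \<gamma> X + sqrt (1 + \<delta>) Z\<close>. Its error is computed by changing
  the Gaussian measure, which costs a factor at most \<open>exp (\<delta> \<bar>Z\<bar>\<^sup>2 / 2)\<close>. To first order F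
  therefore grows in u at a rate of at most \<open>E[\<bar>V\<bar>\<^sup>2 \<bar>Z\<bar>\<^sup>2] / 2\<close>, with a quadratic remainder that is
  uniform in u. Expanding \<open>Z = m + V\<close> and using \<open>E[\<bar>m\<bar>\<^sup>2 m \<bullet> V] = 0\<close>, this rate is at most
  \<open>E\<bar>Z\<bar>^4 - E\<bar>m\<bar>^4 = n (n + 2) - E\<bar>m\<bar>^4\<close>. Summing over a fine subdivision and dropping \<open>E\<bar>m\<bar>^4\<close>
  gives the first inequality. If \<open>E\<bar>X\<bar>\<^sup>2 \<le> n\<close>, comparison with the linear estimator gives
  \<open>E\<bar>m\<bar>\<^sup>2 \<ge> n / (1 + \<gamma>)\<close>, hence \<open>E\<bar>m\<bar>^4 \<ge> n / (1 + \<gamma>)\<^sup>2\<close>, whose integral over u is \<open>n \<Delta>\<close>.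
  No differentiability of the mmse is needed.\<close>

section \<open>Real and measure-theoretic preliminaries\<close>

text \<open>Standard induction on non-negative Borel functions: a set of the pulled-back algebra is
  a preimage, and scaling, sums and suprema carry over to the factors. This later turns an optimal
  estimator into a genuine function that can be evaluated at other observations.\<close>

lemma measurable_vimage_algebra_factor_ennreal:
  fixes u :: "'a \<Rightarrow> ennreal"
  assumes "u \<in> borel_measurable (vimage_algebra S Y N)" and Y: "Y \<in> S \<rightarrow> space N"
  shows "\<exists>g\<in>borel_measurable N. \<forall>x\<in>S. u x = g (Y x)"
  using assms(1)
proof (induct u rule: borel_measurable_induct)
  case (cong f g)
  then show ?case by (metis space_vimage_algebra)
next
  case (set A)
  then obtain B where B: "B \<in> sets N" "A = Y -` B \<inter> S"
    using sets_vimage_algebra2[OF Y] by auto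
  then show ?case
    by (intro bexI[where x = "indicator B"]) (auto simp: indicator_def)
next
  case (mult u c)
  from mult(4) obtain g where g: "g \<in> borel_measurable N" "\<forall>x\<in>S. u x = g (Y x)" by blast
  show ?case by (rule bexI[where x = "\<lambda>y. c * g y"]) (use g in simp_all)
next
  case (add u v)
  from add(3,7) obtain g h where gh: "g \<in> borel_measurable N" "\<forall>x\<in>S. u x = g (Y x)"
    "h \<in> borel_measurable N" "\<forall>x\<in>S. v x = h (Y x)" by blast
  show ?case by (rule bexI[where x = "\<lambda>y. h y + g y"]) (use gh in simp_all)
next
  case (seq U)
  from seq(3) obtain g where g: "\<And>i. g i \<in> borel_measurable N" "\<And>i x. x \<in> S \<Longrightarrow> U i x = g i (Y x)"
    by metis
  show ?case
    by (rule bexI[where x = "\<lambda>y. SUP i. g i y"]) (use g in \<open>simp_all add: image_comp\<close>)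
qed

lemma measurable_vimage_algebra_factor_real:
  fixes u :: "'a \<Rightarrow> real"
  assumes [measurable]: "u \<in> borel_measurable (vimage_algebra S Y N)" and Y: "Y \<in> S \<rightarrow> space N"
  shows "\<exists>g\<in>borel_measurable N. \<forall>x\<in>S. u x = g (Y x)"
proof -
  \<comment> \<open>\<open>ennreal\<close> sends negative reals to 0, so these are the positive and
    the negative part of \<open>u\<close>.\<close>
  have "(\<lambda>x. ennreal (u x)) \<in> borel_measurable (vimage_algebra S Y N)"
    "(\<lambda>x. ennreal (- u x)) \<in> borel_measurable (vimage_algebra S Y N)"
    by measurable
  then obtain g h where gh: "g \<in> borel_measurable N" "\<forall>x\<in>S. ennreal (u x) = g (Y x)"
    "h \<in> borel_measurable N" "\<forall>x\<in>S. ennreal (- u x) = h (Y x)"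
    using measurable_vimage_algebra_factor_ennreal[OF _ Y] by metis
  show ?thesis
  proof (intro bexI[where x = "\<lambda>y. enn2real (g y) - enn2real (h y)"] ballI)
    show "u x = enn2real (g (Y x)) - enn2real (h (Y x))" if "x \<in> S" for x
      using gh(2)[rule_format, OF that, symmetric] gh(4)[rule_format, OF that, symmetric]
      by (cases "u x \<ge> 0") (simp_all add: ennreal_neg)
  qed (use gh(1,3) in measurable)
qed

lemma borel_measurable_vec_nth [measurable (raw)]:
  fixes f :: "'a \<Rightarrow> real ^ 'n"
  assumes "f \<in> borel_measurable M"
  shows "(\<lambda>x. f x $ i) \<in> borel_measurable M"
  using borel_measurable_inner[OF assms borel_measurable_const[of "axis i 1"]]
  by (simp add: inner_axis)

lemma borel_measurable_vecI:
  fixes f :: "'a \<Rightarrow> real ^ 'n"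
  assumes "\<And>i. (\<lambda>x. f x $ i) \<in> borel_measurable M"
  shows "f \<in> borel_measurable M"
  unfolding borel_measurable_euclidean_space[of f]
  using assms by (auto simp: Basis_vec_def inner_axis)

lemma measurable_vimage_algebra_factor_vec:
  fixes u :: "'a \<Rightarrow> real ^ 'n"
  assumes "\<And>i. (\<lambda>x. u x $ i) \<in> borel_measurable (vimage_algebra S Y N)"
    and Y: "Y \<in> S \<rightarrow> space N"
  obtains g where "g \<in> borel_measurable N" "\<And>x. x \<in> S \<Longrightarrow> u x = g (Y x)"
proof -
  obtain g where g: "\<And>i. g i \<in> borel_measurable N" "\<And>i x. x \<in> S \<Longrightarrow> u x $ i = g i (Y x)"
    using measurable_vimage_algebra_factor_real[OF assms] by metis
  show thesis
    by (rule that[of "\<lambda>y. \<chi> i. g i y"]) (auto intro!: borel_measurable_vecI simp: g vec_eq_iff)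
qed

text \<open>Over \<open>N\<close> equal steps the increments telescope to at most
  \<open>C * (b - a)\<^sup>2 / N\<close>, which tends to 0. This serves in place of a derivative
  argument and assumes no regularity of \<open>G\<close>.\<close>

lemma le_of_quadratic_increments:
  fixes G :: "real \<Rightarrow> real"
  assumes "a \<le> b" "\<eta> > 0"
    and incr: "\<And>u v. a \<le> u \<Longrightarrow> u \<le> v \<Longrightarrow> v \<le> b \<Longrightarrow> v - u \<le> \<eta> \<Longrightarrow> G v - G u \<le> C * (v - u)\<^sup>2"
  shows "G b \<le> G a"
proof -
  have bound: "G b - G a \<le> C * (b - a)\<^sup>2 / real N" if N: "real N \<ge> (b - a) / \<eta>" "N > 0" for N
  proof -
    define h where "h = (b - a) / real N"
    have h: "h \<ge> 0" "h \<le> \<eta>" "a + real N * h = b"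
      using that assms by (auto simp: h_def field_simps)
    have step: "G (a + real (Suc k) * h) - G (a + real k * h) \<le> C * h\<^sup>2" if "k < N" for k
    proof -
      have "real (Suc k) * h \<le> real N * h"
        using that h(1) by (intro mult_right_mono) auto
      then show ?thesis
        using incr[of "a + real k * h" "a + real (Suc k) * h"] h by (auto simp: algebra_simps)
    qed
    have "G b - G a = (\<Sum>k<N. G (a + real (Suc k) * h) - G (a + real k * h))"
      using sum_lessThan_telescope[of "\<lambda>k. G (a + real k * h)" N] h(3) by simp
    also have "\<dots> \<le> (\<Sum>k<N. C * h\<^sup>2)" by (intro sum_mono step) auto
    also have "\<dots> = C * (b - a)\<^sup>2 / real N"
      using N by (simp add: h_def power2_eq_square field_simps)
    finally show ?thesis .
  qed
  have "eventually (\<lambda>N. G b - G a \<le> C * (b - a)\<^sup>2 / real N) sequentially"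
    using eventually_gt_at_top[of 0] filterlim_real_sequentially[unfolded filterlim_at_top, rule_format, of "(b - a) / \<eta>"]
    by eventually_elim (rule bound)
  moreover have "(\<lambda>N. C * (b - a)\<^sup>2 / real N) \<longlonglongrightarrow> 0" by real_asymp
  ultimately have "G b - G a \<le> 0"
    using tendsto_lowerbound[of _ 0 sequentially "G b - G a"] by auto
  then show ?thesis by simp
qed

section \<open>The Gaussian density, its dilation and its moments\<close>

text \<open>The product formula for Lebesgue measure runs over \<open>Basis\<close>; the basis
  vectors \<open>axis i 1\<close> are reindexed by their coordinates.\<close>

lemma nn_integral_lborel_vec_prod:
  fixes f :: "'n::finite \<Rightarrow> real \<Rightarrow> real"
  assumes [measurable]: "\<And>i. f i \<in> borel_measurable borel" and nn: "\<And>i x. 0 \<le> f i x"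
  shows "(\<integral>\<^sup>+z. ennreal (\<Prod>i\<in>UNIV. f i (z $ i)) \<partial>(lborel :: (real ^ 'n) measure))
    = (\<Prod>i\<in>UNIV. \<integral>\<^sup>+x. ennreal (f i x) \<partial>lborel)"
proof -
  define ax where "ax = (\<lambda>i::'n. axis i (1::real))"
  have inj: "inj ax" by (auto simp: ax_def inj_def axis_eq_axis)
  have B: "(Basis :: (real^'n) set) = range ax" by (auto simp: ax_def Basis_vec_def)
  have inv: "inv ax (ax i) = i" for i using inj by simp
  have "(\<integral>\<^sup>+z. (\<Prod>b\<in>Basis. ennreal (f (inv ax b) (z \<bullet> b))) \<partial>(lborel :: (real ^ 'n) measure))
    = (\<Prod>b\<in>Basis. \<integral>\<^sup>+x. ennreal (f (inv ax b) x) \<partial>lborel)"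
    by (rule nn_integral_lborel_prod) auto
  then show ?thesis
    unfolding B prod.reindex[OF inj] o_def inv using nn
    by (simp add: ax_def inner_axis prod_ennreal)
qed

lemma norm_power2_vec: "(norm (z :: real ^ 'n))\<^sup>2 = (\<Sum>i\<in>UNIV. (z $ i)\<^sup>2)"
  by (simp add: norm_vec_def L2_set_def sum_nonneg)

lemma std_gaussian_density_eq:
  "std_gaussian_density (z :: real ^ 'n)
    = (1 / sqrt (2 * pi)) ^ CARD('n) * exp (- (norm z)\<^sup>2 / 2)"
proof -
  have "(\<Prod>i\<in>UNIV. exp (- (z $ i)\<^sup>2 / 2)) = exp (\<Sum>i\<in>UNIV. - (z $ i)\<^sup>2 / 2)"
    by (simp add: exp_sum)
  also have "(\<Sum>i\<in>UNIV. - (z $ i)\<^sup>2 / 2) = - (norm z)\<^sup>2 / 2"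
    unfolding norm_power2_vec by (simp only: sum_divide_distrib[symmetric] sum_negf)
  finally show ?thesis
    unfolding std_gaussian_density_def std_normal_density_def prod.distrib by simp
qed

lemma std_gaussian_density_nonneg: "0 \<le> std_gaussian_density z"
  by (simp add: std_gaussian_density_eq)

lemma borel_measurable_std_gaussian_density[measurable]:
  "std_gaussian_density \<in> borel_measurable borel"
  unfolding std_gaussian_density_eq[abs_def] by measurable

text \<open>The Jacobian \<open>r ^ - n \<le> 1\<close> of the dilation is dropped.\<close>
lemma nn_integral_gaussian_scale_le:
  fixes \<psi> :: "real ^ 'n \<Rightarrow> ennreal"
  assumes [measurable]: "\<psi> \<in> borel_measurable borel" and r: "r \<ge> 1"
  shows "(\<integral>\<^sup>+z. ennreal (std_gaussian_density z) * \<psi> (r *\<^sub>R z) \<partial>lborel)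
    \<le> (\<integral>\<^sup>+z. ennreal (std_gaussian_density z) * (\<psi> z * ennreal (exp ((r\<^sup>2 - 1) * (norm z)\<^sup>2 / 2))) \<partial>lborel)"
proof -
  define G where "G = (\<lambda>w::real^'n. ennreal (std_gaussian_density ((1 / r) *\<^sub>R w)) * \<psi> w)"
  have [measurable]: "G \<in> borel_measurable borel" unfolding G_def by measurable
  have rn: "1 \<le> ennreal (r ^ CARD('n))"
    using r by (simp add: one_le_power flip: ennreal_1)
  have "(\<integral>\<^sup>+z. ennreal (std_gaussian_density z) * \<psi> (r *\<^sub>R z) \<partial>lborel) = (\<integral>\<^sup>+z. G (r *\<^sub>R z) \<partial>lborel)"
    using r by (auto simp: G_def)
  also have "\<dots> \<le> (\<integral>\<^sup>+z. ennreal (r ^ CARD('n)) * G (r *\<^sub>R z) \<partial>lborel)"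
    using rn by (intro nn_integral_mono) (metis mult_1 mult_right_mono zero_le)
  also have "\<dots> = (\<integral>\<^sup>+z. G z \<partial>lborel)"
    using r by (subst (2) lborel_affine[of r 0]) (auto simp: nn_integral_density nn_integral_distr ennreal_power)
  also have "\<dots> \<le> (\<integral>\<^sup>+z. ennreal (std_gaussian_density z) * (\<psi> z * ennreal (exp ((r\<^sup>2 - 1) * (norm z)\<^sup>2 / 2))) \<partial>lborel)"
  proof (rule nn_integral_mono)
    fix z :: "real ^ 'n"
    \<comment> \<open>This amounts to \<open>1 / r\<^sup>2 \<ge> 2 - r\<^sup>2\<close>. It replaces
      the exact coefficient \<open>1 - 1 / r\<^sup>2\<close> in the exponent of the density ratio by
      \<open>r\<^sup>2 - 1\<close>, the increase of the noise variance.\<close>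
    have "0 \<le> (r\<^sup>2 - 1)\<^sup>2 / r\<^sup>2" by simp
    also have "(r\<^sup>2 - 1)\<^sup>2 / r\<^sup>2 = r\<^sup>2 - 2 + 1 / r\<^sup>2" using r by (simp add: field_simps power2_eq_square)
    finally have "(norm z)\<^sup>2 * (2 - r\<^sup>2) \<le> (norm z)\<^sup>2 * (1 / r\<^sup>2)"
      by (intro mult_left_mono) auto
    then have "- (norm z)\<^sup>2 / (2 * r\<^sup>2) \<le> - (norm z)\<^sup>2 / 2 + (r\<^sup>2 - 1) * (norm z)\<^sup>2 / 2"
      by (simp add: field_simps)
    then have "std_gaussian_density ((1 / r) *\<^sub>R z)
        \<le> std_gaussian_density z * exp ((r\<^sup>2 - 1) * (norm z)\<^sup>2 / 2)"
      by (simp add: std_gaussian_density_eq exp_add[symmetric] power_divide mult.assoc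
          divide_right_mono mult.commute)
    then have "ennreal (std_gaussian_density ((1 / r) *\<^sub>R z))
        \<le> ennreal (std_gaussian_density z) * ennreal (exp ((r\<^sup>2 - 1) * (norm z)\<^sup>2 / 2))"
      by (simp add: std_gaussian_density_nonneg flip: ennreal_mult)
    then have "G z \<le> ennreal (std_gaussian_density z) * ennreal (exp ((r\<^sup>2 - 1) * (norm z)\<^sup>2 / 2)) * \<psi> z"
      unfolding G_def by (intro mult_right_mono) auto
    then show "G z \<le> ennreal (std_gaussian_density z) * (\<psi> z * ennreal (exp ((r\<^sup>2 - 1) * (norm z)\<^sup>2 / 2)))"
      by (simp add: mult_ac)
  qed
  finally show ?thesis .
qed

text \<open>With \<open>x = \<delta> * t / 2\<close>, the remainder of \<open>1 + x\<close> is at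
  most \<open>x\<^sup>2 * exp x\<close>; the polynomial factor is absorbed into
  \<open>exp (t / 16)\<close> and \<open>exp x\<close> is at most \<open>exp (t / 8)\<close>. The
  lemma is applied to the squared norm of the noise, and 3/16 lies below 1/4, so the square of the
  remainder is still Gaussian integrable.\<close>

lemma exp_le_quadratic_remainder:
  fixes t \<delta> :: real
  assumes "0 \<le> t" "0 \<le> \<delta>" "\<delta> \<le> 1 / 4"
  shows "exp (\<delta> * t / 2) \<le> 1 + \<delta> * t / 2 + 128 * \<delta>\<^sup>2 * exp (3 * t / 16)"
proof -
  define x where "x = \<delta> * t / 2"
  have x: "x \<ge> 0" "x \<le> t / 8"
    using assms mult_right_mono[OF assms(3,1)] by (auto simp: x_def)
  have "1 - x \<le> exp (- x)" using exp_ge_add_one_self[of "- x"] by simp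
  then have "(1 - x) * exp x \<le> exp (- x) * exp x" by (intro mult_right_mono) auto
  then have 1: "exp x - 1 \<le> x * exp x" by (simp add: exp_minus algebra_simps)
  have "x * (exp x - 1) \<le> x * (x * exp x)" by (intro mult_left_mono 1 x)
  then have 2: "exp x \<le> 1 + x + x\<^sup>2 * exp x" using 1 by (simp add: algebra_simps power2_eq_square)
  \<comment> \<open>The quadratic Taylor term of \<open>exp (t / 16)\<close> is
    \<open>t\<^sup>2 / 512\<close>.\<close>
  have "t\<^sup>2 \<le> 512 * exp (t / 16)"
    using exp_lower_Taylor_quadratic[of "t / 16"] assms(1) by (simp add: power_divide)
  then have "\<delta>\<^sup>2 / 4 * t\<^sup>2 \<le> \<delta>\<^sup>2 / 4 * (512 * exp (t / 16))" by (intro mult_left_mono) auto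
  then have "x\<^sup>2 \<le> 128 * \<delta>\<^sup>2 * exp (t / 16)" by (simp add: x_def power_mult_distrib power_divide)
  then have "x\<^sup>2 * exp x \<le> 128 * \<delta>\<^sup>2 * exp (t / 16) * exp (t / 8)"
    using x by (intro mult_mono) auto
  also have "\<dots> = 128 * \<delta>\<^sup>2 * exp (3 * t / 16)"
    by (simp add: mult.assoc flip: exp_add)
  finally show ?thesis using 2 by (simp add: x_def)
qed

lemma std_normal_moments:
  "has_bochner_integral lborel std_normal_density 1"
  "has_bochner_integral lborel (\<lambda>x. std_normal_density x * x\<^sup>2) 1"
  "has_bochner_integral lborel (\<lambda>x. std_normal_density x * x ^ 4) 3"
  "has_bochner_integral lborel (\<lambda>x. std_normal_density x * exp (3 / 8 * x\<^sup>2)) 2"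
proof -
  show "has_bochner_integral lborel std_normal_density 1"
    using std_normal_moment_even[of 0] by simp
  show "has_bochner_integral lborel (\<lambda>x. std_normal_density x * x\<^sup>2) 1"
    using std_normal_moment_even[of 1] by simp
  show "has_bochner_integral lborel (\<lambda>x. std_normal_density x * x ^ 4) 3"
    using std_normal_moment_even[of 2] by (simp add: fact_numeral)
  \<comment> \<open>As 3/8 - 1/2 = -1/8, the weighted density is twice the normal density of
    standard deviation 2.\<close>
  have "has_bochner_integral lborel (\<lambda>x. 2 * normal_density 0 2 x) (2 * 1)"
    by (intro has_bochner_integral_mult_right)
      (auto simp: has_bochner_integral_iff integrable_normal_density integral_normal_density)
  moreover have "2 * normal_density 0 2 x = std_normal_density x * exp (3 / 8 * x\<^sup>2)" for x
    using real_sqrt_mult[of 4 2]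
    by (simp add: normal_density_def real_sqrt_mult flip: exp_add)
  ultimately show "has_bochner_integral lborel (\<lambda>x. std_normal_density x * exp (3 / 8 * x\<^sup>2)) 2"
    by simp
qed

section \<open>Matrix-valued integrals and integrability criteria\<close>

lemma outer_nth: "outer v $ i $ j = v $ i * v $ j"
  by (simp add: outer_def columnvector_def rowvector_def matrix_matrix_mult_def UNIV_1)

text \<open>Expanding the matrix in the elementary matrices \<open>axis i (axis j 1)\<close> gives
  integrability of the whole function; the entry projection is bounded linear and then commutes with
  the integral.\<close>

lemma integral_matrix_nth:
  fixes h :: "'n::finite \<Rightarrow> 'm::finite \<Rightarrow> 'a \<Rightarrow> real"
  assumes h: "\<And>i j. integrable M (h i j)"
  shows "(integral\<^sup>L M (\<lambda>\<omega>. \<chi> i j. h i j \<omega>)) $ i $ j = integral\<^sup>L M (h i j)"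
proof -
  have "(\<Sum>j'\<in>UNIV. h i' j' \<omega> * axis i' (axis j' 1) $ i $ j) = (if i = i' then h i' j \<omega> else 0)"
    for i i' :: 'n and j :: 'm and \<omega>
    by (cases "i = i'") (simp_all add: axis_def if_distrib[of "times _"] cong: if_cong)
  then have eq: "(\<chi> i j. h i j \<omega>) = (\<Sum>i\<in>UNIV. \<Sum>j\<in>UNIV. h i j \<omega> *\<^sub>R axis i (axis j 1))" for \<omega>
    by (simp add: vec_eq_iff)
  have int: "integrable M (\<lambda>\<omega>. \<chi> i j. h i j \<omega>)"
    unfolding eq by (intro Bochner_Integration.integrable_sum integrable_scaleR_left h)
  have "bounded_linear (\<lambda>A :: real ^ 'm ^ 'n. A $ i $ j)"
    by (intro bounded_linear_compose[OF bounded_linear_vec_nth bounded_linear_vec_nth])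
  from integral_bounded_linear[OF this int] show ?thesis by simp
qed

lemma integrable_mult_squares:
  fixes f g :: "'a \<Rightarrow> real"
  assumes [measurable]: "f \<in> borel_measurable M" "g \<in> borel_measurable M"
    and int: "integrable M (\<lambda>x. (f x)\<^sup>2)" "integrable M (\<lambda>x. (g x)\<^sup>2)"
  shows "integrable M (\<lambda>x. f x * g x)"
proof (rule Bochner_Integration.integrable_bound)
  show "integrable M (\<lambda>x. (f x)\<^sup>2 + (g x)\<^sup>2)" using int by simp
  have "\<bar>f x * g x\<bar> \<le> (f x)\<^sup>2 + (g x)\<^sup>2" for x
  proof -
    have "2 * (\<bar>f x\<bar> * \<bar>g x\<bar>) \<le> \<bar>f x\<bar>\<^sup>2 + \<bar>g x\<bar>\<^sup>2"
      using sum_squares_bound[of "\<bar>f x\<bar>" "\<bar>g x\<bar>"] by simp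
    moreover have "0 \<le> \<bar>f x\<bar> * \<bar>g x\<bar>" by simp
    ultimately show ?thesis unfolding abs_mult power2_abs by linarith
  qed
  then show "AE x in M. norm (f x * g x) \<le> norm ((f x)\<^sup>2 + (g x)\<^sup>2)" by auto
qed measurable

lemma integrable_of_nonneg_le:
  fixes f g :: "'a \<Rightarrow> real"
  assumes "integrable M g" "f \<in> borel_measurable M" "\<And>x. 0 \<le> f x" "\<And>x. f x \<le> g x"
  shows "integrable M f"
proof (rule Bochner_Integration.integrable_bound[OF assms(1,2)], rule AE_I2)
  show "norm (f x) \<le> norm (g x)" for x
    using assms(3)[of x] assms(4)[of x] by simp
qed

section \<open>Pointwise inequalities and the antiderivatives behind the correction term\<close>

text \<open>Cauchy-Schwarz against the constant 1. It reduces fourth moments of a norm to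
  coordinates, where the scalar Jensen inequality applies.\<close>

lemma norm4_le_vec: "((norm (v :: real ^ 'n))\<^sup>2)\<^sup>2 \<le> real CARD('n) * (\<Sum>i\<in>UNIV. (v $ i) ^ 4)"
proof -
  have "((norm v)\<^sup>2)\<^sup>2 \<le> (\<Sum>i\<in>UNIV. ((v $ i)\<^sup>2)\<^sup>2) * real CARD('n)"
    unfolding norm_power2_vec by (rule sum_squared_le_sum_of_squares)
  then show ?thesis by (simp add: mult.commute flip: power_mult)
qed

text \<open>Used with \<open>a = \<bar>V\<bar>\<^sup>2\<close>, \<open>b = m \<bullet> V\<close>, \<open>c = \<bar>m\<bar>\<^sup>2\<close> for a vector \<open>m + V\<close>: the difference of the two sides is
  \<open>(a + 3 b)\<^sup>2 / 2 + (a c - b\<^sup>2) / 2 + a c\<close>.\<close>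
lemma sum_mult_mean_square_le:
  fixes a b c :: real
  assumes "b\<^sup>2 \<le> a * c" and "0 \<le> a" "0 \<le> c"
  shows "a * (a + 2 * b + c) / 2 + c\<^sup>2 + 4 * (b * c) \<le> (a + 2 * b + c)\<^sup>2"
proof -
  have "0 \<le> (a + 3 * b)\<^sup>2 / 2 + (a * c - b\<^sup>2) / 2 + a * c"
    using assms by (intro add_nonneg_nonneg) auto
  also have "\<dots> = (a + 2 * b + c)\<^sup>2 - (a * (a + 2 * b + c) / 2 + c\<^sup>2 + 4 * (b * c))"
    by (simp add: power2_eq_square field_simps)
  finally show ?thesis by simp
qed

text \<open>\<open>W\<close> is an antiderivative of \<open>(u / (1 + u))\<^sup>2\<close>, which is
  2-Lipschitz on the positive axis, so the left-endpoint rectangle misses only a quadratic term. For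
  \<open>u = 1 / \<gamma>\<close> the integrand is
  \<open>1 / (1 + \<gamma>)\<^sup>2\<close>.\<close>

lemma odds_square_antiderivative_increment:
  fixes u v :: real
  assumes u: "0 < u" "u \<le> v"
  defines "W \<equiv> \<lambda>u. u - 2 * ln (1 + u) - 1 / (1 + u)"
  shows "W v - W u \<le> (u / (1 + u))\<^sup>2 * (v - u) + 2 * (v - u)\<^sup>2"
proof (cases "u = v")
  case False
  have deriv: "(W has_real_derivative (x / (1 + x))\<^sup>2) (at x)" if "u \<le> x" for x
  proof -
    have "x > 0" using that u by simp
    then have "(W has_real_derivative 1 + (1 / (1 + x))\<^sup>2 - 2 * (1 / (1 + x))) (at x)"
      unfolding W_def by (auto intro!: derivative_eq_intros simp: power2_eq_square)
    moreover have "x / (1 + x) = 1 - 1 / (1 + x)" using \<open>x > 0\<close> by (simp add: field_simps)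
    ultimately show ?thesis by (simp add: power2_diff)
  qed
  obtain z where z: "u < z" "z < v" "W v - W u = (v - u) * (z / (1 + z))\<^sup>2"
    using MVT2[of u v W "\<lambda>x. (x / (1 + x))\<^sup>2"] u False deriv by auto
  \<comment> \<open>In the difference of squares, the first factor is at most \<open>z - u\<close>,
    the second at most 2.\<close>
  have "(z / (1 + z))\<^sup>2 - (u / (1 + u))\<^sup>2 = (z / (1 + z) - u / (1 + u)) * (z / (1 + z) + u / (1 + u))"
    by (simp add: power2_eq_square algebra_simps)
  also have "\<dots> \<le> (v - u) * 2"
  proof (rule mult_mono)
    have "z / (1 + z) - u / (1 + u) = (z - u) / ((1 + z) * (1 + u))"
      using z u by (simp add: field_simps)
    also have "\<dots> \<le> (z - u) / 1"
    proof (rule divide_left_mono)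
      show "1 \<le> (1 + z) * (1 + u)" using z u by (simp add: algebra_simps)
    qed (use z u in auto)
    finally show "z / (1 + z) - u / (1 + u) \<le> v - u" using z by simp
    have "z / (1 + z) \<le> 1" "u / (1 + u) \<le> 1" using z u by auto
    then show "z / (1 + z) + u / (1 + u) \<le> 2" by linarith
  qed (use z u in auto)
  finally have "(v - u) * (z / (1 + z))\<^sup>2 \<le> (v - u) * ((u / (1 + u))\<^sup>2 + 2 * (v - u))"
    using u by (intro mult_left_mono) auto
  then show ?thesis unfolding z(3) by (simp add: power2_eq_square algebra_simps)
qed simp

lemma has_integral_inverse_square_product:
  fixes s t :: real
  assumes "0 < s" "s \<le> t"
  shows "((\<lambda>\<gamma>. 1 / (\<gamma>\<^sup>2 * (1 + \<gamma>)\<^sup>2)) has_integral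
    2 * ln ((1 + t) / (1 + s)) - 2 * ln (t / s) + 1 / (1 + s) - 1 / (1 + t) + 1 / s - 1 / t) {s..t}"
proof -
  define P where "P = (\<lambda>\<gamma>::real. 2 * ln (1 + \<gamma>) - 2 * ln \<gamma> - 1 / (1 + \<gamma>) - 1 / \<gamma>)"
  have "((\<lambda>\<gamma>. 1 / (\<gamma>\<^sup>2 * (1 + \<gamma>)\<^sup>2)) has_integral P t - P s) {s..t}"
  proof (rule fundamental_theorem_of_calculus)
    fix x assume "x \<in> {s..t}"
    then have x: "x > 0" using assms by auto
    have "(P has_real_derivative (2 / (1 + x) - 2 / x + 1 / (1 + x)\<^sup>2 + 1 / x\<^sup>2)) (at x)"
      unfolding P_def using x
      by (auto intro!: derivative_eq_intros simp: power2_eq_square)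
    moreover have "2 / (1 + x) - 2 / x + 1 / (1 + x)\<^sup>2 + 1 / x\<^sup>2 = 1 / (x\<^sup>2 * (1 + x)\<^sup>2)"
    proof -
      \<comment> \<open>Squaring this partial fraction leaves a cross term to which the same
        decomposition applies again.\<close>
      have "1 / (x * (1 + x)) = 1 / x - 1 / (1 + x)" using x by (simp add: field_simps)
      moreover from this have "1 / x * (1 / (1 + x)) = 1 / x - 1 / (1 + x)" by simp
      ultimately have "(1 / (x * (1 + x)))\<^sup>2 = (1 / x)\<^sup>2 + (1 / (1 + x))\<^sup>2 - 2 * (1 / x - 1 / (1 + x))"
        by (simp only: power2_diff mult.assoc)
      then show ?thesis by (simp add: power_divide power_mult_distrib)
    qed
    ultimately show "(P has_vector_derivative 1 / (x\<^sup>2 * (1 + x)\<^sup>2)) (at x within {s..t})"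
      by (simp add: has_field_derivative_at_within has_real_derivative_iff_has_vector_derivative[symmetric])
  qed (use assms in auto)
  moreover have "P t - P s = 2 * ln ((1 + t) / (1 + s)) - 2 * ln (t / s)
      + 1 / (1 + s) - 1 / (1 + t) + 1 / s - 1 / t"
    using assms by (simp add: P_def ln_div)
  ultimately show ?thesis by simp
qed

section \<open>The Gaussian channel\<close>

locale gaussian_channel = prob_space M for M :: "'a measure" +
  fixes X Z :: "'a \<Rightarrow> real ^ 'n"
  assumes measurable_X[measurable]: "X \<in> borel_measurable M"
    and distributed_Z: "distributed M lborel Z (\<lambda>z. ennreal (std_gaussian_density z))"
    and indep_X_Z: "indep_var borel X borel Z"
begin

lemma measurable_Z[measurable]: "Z \<in> borel_measurable M"
  using distributed_measurable[OF distributed_Z] by simp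

text \<open>By independence the joint law is a product, and Tonelli exposes the Gaussian density for
  each fixed value of \<open>X\<close>. The noise can thus be changed without touching the
  signal.\<close>

lemma nn_integral_X_Z:
  assumes [measurable]: "H \<in> borel_measurable (borel \<Otimes>\<^sub>M borel)"
  shows "(\<integral>\<^sup>+\<omega>. H (X \<omega>, Z \<omega>) \<partial>M)
    = (\<integral>\<^sup>+x. \<integral>\<^sup>+z. ennreal (std_gaussian_density z) * H (x, z) \<partial>lborel \<partial>distr M borel X)"
proof -
  interpret DZ: prob_space "distr M borel Z" by (rule prob_space_distr) measurable
  have D: "distr M borel Z = density lborel (\<lambda>z. ennreal (std_gaussian_density z))"
    using distributed_distr_eq_density[OF distributed_Z] by (metis distr_cong sets_lborel)
  have "(\<integral>\<^sup>+\<omega>. H (X \<omega>, Z \<omega>) \<partial>M)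
      = (\<integral>\<^sup>+p. H p \<partial>distr M (borel \<Otimes>\<^sub>M borel) (\<lambda>\<omega>. (X \<omega>, Z \<omega>)))"
    by (subst nn_integral_distr) auto
  also have "\<dots> = (\<integral>\<^sup>+p. H p \<partial>(distr M borel X \<Otimes>\<^sub>M distr M borel Z))"
    using indep_X_Z unfolding indep_var_distribution_eq by simp
  also have "\<dots> = (\<integral>\<^sup>+x. \<integral>\<^sup>+z. H (x, z) \<partial>distr M borel Z \<partial>distr M borel X)"
    by (subst DZ.nn_integral_fst[symmetric]) (auto cong: measurable_cong_sets)
  also have "\<dots> = (\<integral>\<^sup>+x. \<integral>\<^sup>+z. ennreal (std_gaussian_density z) * H (x, z) \<partial>lborel \<partial>distr M borel X)"
    unfolding D by (subst nn_integral_density) auto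
  finally show ?thesis .
qed

text \<open>The dilation bound is applied for each fixed value of \<open>X\<close>; the exponential
  weight is the price of replacing the stronger noise \<open>r *\<^sub>R Z\<close> by
  \<open>Z\<close>.\<close>

lemma nn_integral_scale_noise_le:
  assumes [measurable]: "H \<in> borel_measurable (borel \<Otimes>\<^sub>M borel)" and r: "r \<ge> 1"
  shows "(\<integral>\<^sup>+\<omega>. H (X \<omega>, r *\<^sub>R Z \<omega>) \<partial>M)
    \<le> (\<integral>\<^sup>+\<omega>. H (X \<omega>, Z \<omega>) * ennreal (exp ((r\<^sup>2 - 1) * (norm (Z \<omega>))\<^sup>2 / 2)) \<partial>M)"
proof -
  have "(\<integral>\<^sup>+\<omega>. H (X \<omega>, r *\<^sub>R Z \<omega>) \<partial>M)
      = (\<integral>\<^sup>+x. \<integral>\<^sup>+z. ennreal (std_gaussian_density z) * H (x, r *\<^sub>R z) \<partial>lborel \<partial>distr M borel X)"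
    using nn_integral_X_Z[of "\<lambda>p. H (fst p, r *\<^sub>R snd p)"] by simp
  also have "\<dots> \<le> (\<integral>\<^sup>+x. \<integral>\<^sup>+z. ennreal (std_gaussian_density z)
      * (H (x, z) * ennreal (exp ((r\<^sup>2 - 1) * (norm z)\<^sup>2 / 2))) \<partial>lborel \<partial>distr M borel X)"
    by (intro nn_integral_mono nn_integral_gaussian_scale_le r) auto
  also have "\<dots> = (\<integral>\<^sup>+\<omega>. H (X \<omega>, Z \<omega>) * ennreal (exp ((r\<^sup>2 - 1) * (norm (Z \<omega>))\<^sup>2 / 2)) \<partial>M)"
    using nn_integral_X_Z[of "\<lambda>p. H p * ennreal (exp ((r\<^sup>2 - 1) * (norm (snd p))\<^sup>2 / 2))"] by simp
  finally show ?thesis .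
qed

section \<open>Moments of the noise\<close>

text \<open>The density is a product over coordinates. As the factors are non-negative, the product
  formula yields integrability and the value together.\<close>

lemma expectation_prod_Z:
  fixes h :: "'n \<Rightarrow> real \<Rightarrow> real"
  assumes [measurable]: "\<And>i. h i \<in> borel_measurable borel" and h: "\<And>i x. 0 \<le> h i x"
    and c: "\<And>i. has_bochner_integral lborel (\<lambda>x. std_normal_density x * h i x) (c i)"
  shows "has_bochner_integral M (\<lambda>\<omega>. \<Prod>i\<in>UNIV. h i (Z \<omega> $ i)) (\<Prod>i\<in>UNIV. c i)"
proof (rule has_bochner_integral_nn_integral)
  have c0: "c i \<ge> 0" for i
  proof -
    have "0 \<le> (\<integral>x. std_normal_density x * h i x \<partial>lborel)"
      using h by (intro Bochner_Integration.integral_nonneg) auto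
    then show ?thesis using c[of i] by (simp add: has_bochner_integral_iff)
  qed
  show "0 \<le> (\<Prod>i\<in>UNIV. c i)" using c0 by (auto intro: prod_nonneg)
  have "(\<integral>\<^sup>+\<omega>. ennreal (\<Prod>i\<in>UNIV. h i (Z \<omega> $ i)) \<partial>M)
      = (\<integral>\<^sup>+z. ennreal (std_gaussian_density z) * ennreal (\<Prod>i\<in>UNIV. h i (z $ i)) \<partial>lborel)"
    by (rule distributed_nn_integral[OF distributed_Z, symmetric]) measurable
  also have "\<dots> = (\<integral>\<^sup>+z. ennreal (\<Prod>i\<in>UNIV. std_normal_density (z $ i) * h i (z $ i)) \<partial>lborel)"
    using h by (simp add: std_gaussian_density_def prod.distrib ennreal_mult prod_nonneg)
  also have "\<dots> = (\<Prod>i\<in>UNIV. \<integral>\<^sup>+x. ennreal (std_normal_density x * h i x) \<partial>lborel)"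
    using h by (intro nn_integral_lborel_vec_prod) auto
  also have "\<dots> = (\<Prod>i\<in>UNIV. ennreal (c i))"
    using c h by (intro prod.cong refl)
      (simp add: nn_integral_eq_integral has_bochner_integral_iff)
  finally show "(\<integral>\<^sup>+\<omega>. ennreal (\<Prod>i\<in>UNIV. h i (Z \<omega> $ i)) \<partial>M) = ennreal (\<Prod>i\<in>UNIV. c i)"
    using c0 by (simp add: prod_ennreal)
  show "(\<lambda>\<omega>. \<Prod>i\<in>UNIV. h i (Z \<omega> $ i)) \<in> borel_measurable M" by measurable
qed (use h in \<open>auto intro!: prod_nonneg\<close>)

lemma moment_Z2_Z2:
  "has_bochner_integral M (\<lambda>\<omega>. (Z \<omega> $ i)\<^sup>2 * (Z \<omega> $ j)\<^sup>2) (if i = j then 3 else 1)"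
proof -
  \<comment> \<open>Coordinate \<open>k\<close> carries one factor \<open>x\<^sup>2\<close> for each
    of \<open>i\<close>, \<open>j\<close> equal to it, so \<open>i = j\<close> needs no separate
    argument; the fourth moment 3 is then booked at \<open>k = i\<close>.\<close>
  have c: "has_bochner_integral lborel
      (\<lambda>x. std_normal_density x * ((if k = i then x\<^sup>2 else 1) * (if k = j then x\<^sup>2 else 1)))
      (if k = i then (if i = j then 3 else 1) else 1)" for k
    using std_normal_moments by (cases "k = i"; cases "k = j") (auto simp flip: power_add)
  have "has_bochner_integral M
      (\<lambda>\<omega>. \<Prod>k\<in>UNIV. (if k = i then (Z \<omega> $ k)\<^sup>2 else 1) * (if k = j then (Z \<omega> $ k)\<^sup>2 else 1))
      (\<Prod>k\<in>UNIV. if k = i then (if i = j then 3 else 1) else 1)"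
    by (rule expectation_prod_Z[where h = "\<lambda>k x. (if k = i then x\<^sup>2 else 1) * (if k = j then x\<^sup>2 else 1)", OF _ _ c])
      auto
  then show ?thesis by (simp add: prod.distrib)
qed

lemma moment_Z2: "has_bochner_integral M (\<lambda>\<omega>. (Z \<omega> $ i)\<^sup>2) 1"
proof -
  have c: "has_bochner_integral lborel
      (\<lambda>x. std_normal_density x * (if k = i then x\<^sup>2 else 1)) 1" for k
    using std_normal_moments by (cases "k = i") auto
  have "has_bochner_integral M (\<lambda>\<omega>. \<Prod>k\<in>UNIV. if k = i then (Z \<omega> $ k)\<^sup>2 else 1) (\<Prod>k\<in>(UNIV :: 'n set). 1)"
    by (rule expectation_prod_Z[where h = "\<lambda>k x. if k = i then x\<^sup>2 else 1", OF _ _ c]) auto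
  then show ?thesis by simp
qed

lemma moment_norm2_Z: "has_bochner_integral M (\<lambda>\<omega>. (norm (Z \<omega>))\<^sup>2) (real CARD('n))"
proof -
  have "has_bochner_integral M (\<lambda>\<omega>. \<Sum>i\<in>UNIV. (Z \<omega> $ i)\<^sup>2) (\<Sum>i\<in>(UNIV :: 'n set). 1)"
    by (intro has_bochner_integral_sum moment_Z2)
  then show ?thesis by (simp add: norm_power2_vec)
qed

text \<open>In the double sum each row has one diagonal term 3 and n - 1 terms 1. This is the source
  of the constant n + 2 in the theorem.\<close>

lemma moment_norm4_Z:
  "has_bochner_integral M (\<lambda>\<omega>. ((norm (Z \<omega>))\<^sup>2)\<^sup>2) (real CARD('n) * (real CARD('n) + 2))"
proof -
  have "(\<Sum>j\<in>UNIV. if i = j then 3 else 1) = real CARD('n) + 2" for i :: 'n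
  proof -
    have "(\<Sum>j\<in>UNIV. if i = j then 3 else 1) = (\<Sum>j\<in>UNIV. 1 + (if i = j then 2 else 0 :: real))"
      by (intro sum.cong) auto
    then show ?thesis by (simp add: sum.distrib)
  qed
  moreover have "has_bochner_integral M (\<lambda>\<omega>. \<Sum>i\<in>UNIV. \<Sum>j\<in>UNIV. (Z \<omega> $ i)\<^sup>2 * (Z \<omega> $ j)\<^sup>2)
      (\<Sum>i\<in>(UNIV :: 'n set). \<Sum>j\<in>UNIV. if i = j then 3 else 1)"
    by (intro has_bochner_integral_sum moment_Z2_Z2)
  moreover have "((norm z)\<^sup>2)\<^sup>2 = (\<Sum>i\<in>UNIV. \<Sum>j\<in>UNIV. (z $ i)\<^sup>2 * (z $ j)\<^sup>2)" for z :: "real ^ 'n"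
    unfolding norm_power2_vec by (simp only: power2_eq_square[of "sum _ _"] sum_product)
  ultimately show ?thesis by simp
qed

text \<open>Squaring doubles 3/16 to 3/8, for which every coordinate contributes the factor
  2.\<close>

lemma moment_exp_Z:
  "has_bochner_integral M (\<lambda>\<omega>. (exp (3 * (norm (Z \<omega>))\<^sup>2 / 16))\<^sup>2) (2 ^ CARD('n))"
proof -
  have "has_bochner_integral M (\<lambda>\<omega>. \<Prod>k\<in>UNIV. exp (3 / 8 * (Z \<omega> $ k)\<^sup>2)) (\<Prod>k\<in>(UNIV :: 'n set). 2)"
    by (rule expectation_prod_Z[where h = "\<lambda>k x. exp (3 / 8 * x\<^sup>2)"])
      (use std_normal_moments in auto)
  moreover have "(\<Prod>k\<in>UNIV. exp (3 / 8 * (Z \<omega> $ k)\<^sup>2)) = (exp (3 * (norm (Z \<omega>))\<^sup>2 / 16))\<^sup>2" for \<omega>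
  proof -
    have "(\<Prod>k\<in>UNIV. exp (3 / 8 * (Z \<omega> $ k)\<^sup>2)) = exp (3 / 8 * (norm (Z \<omega>))\<^sup>2)"
      unfolding norm_power2_vec sum_distrib_left by (simp only: exp_sum finite)
    also have "\<dots> = (exp (3 * (norm (Z \<omega>))\<^sup>2 / 16))\<^sup>2" by (simp add: power2_eq_square flip: exp_add)
    finally show ?thesis .
  qed
  ultimately show ?thesis by simp
qed

lemma integrable_Z: "integrable M (\<lambda>\<omega>. Z \<omega> $ i)"
proof (rule square_integrable_imp_integrable)
  show "integrable M (\<lambda>\<omega>. (Z \<omega> $ i)\<^sup>2)"
    using moment_Z2[of i] unfolding has_bochner_integral_iff by blast
qed measurable

lemma integrable_Z4: "integrable M (\<lambda>\<omega>. (Z \<omega> $ i) ^ 4)" "expectation (\<lambda>\<omega>. (Z \<omega> $ i) ^ 4) = 3"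
proof -
  have eq: "(Z \<omega> $ i) ^ 4 = (Z \<omega> $ i)\<^sup>2 * (Z \<omega> $ i)\<^sup>2" for \<omega> by (simp flip: power_add)
  show "integrable M (\<lambda>\<omega>. (Z \<omega> $ i) ^ 4)" "expectation (\<lambda>\<omega>. (Z \<omega> $ i) ^ 4) = 3"
    unfolding eq using moment_Z2_Z2[of i i] unfolding has_bochner_integral_iff by auto
qed

text \<open>The integrand is odd and reflection preserves Lebesgue measure, so the integral equals
  its own negative.\<close>

lemma expectation_Z: "expectation (\<lambda>\<omega>. Z \<omega> $ i) = 0"
proof -
  define g where "g = (\<lambda>z :: real ^ 'n. std_gaussian_density z * z $ i)"
  have [measurable]: "g \<in> borel_measurable borel" unfolding g_def by measurable
  have odd: "g (- z) = - g z" for z by (simp add: g_def std_gaussian_density_eq)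
  have "expectation (\<lambda>\<omega>. Z \<omega> $ i) = (\<integral>z. g z \<partial>lborel)"
    unfolding g_def by (rule distributed_integral[OF distributed_Z, symmetric])
      (auto simp: std_gaussian_density_nonneg)
  moreover have "(\<integral>z. g z \<partial>lborel) = - (\<integral>z. g z \<partial>lborel)"
  proof -
    have "(\<integral>z. g z \<partial>lborel) = (\<integral>z. g (- z) \<partial>lborel)"
      by (subst lborel_affine[of "-1" 0]) (auto simp: integral_density integral_distr density_1)
    also have "\<dots> = - (\<integral>z. g z \<partial>lborel)" unfolding odd by simp
    finally show ?thesis .
  qed
  ultimately show ?thesis by simp
qed

section \<open>The conditional mean of the noise\<close>

definition obs :: "real \<Rightarrow> 'a measure" where
  "obs \<gamma> = vimage_algebra (space M) (awgn X Z \<gamma>) borel"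

text \<open>The \<open>m\<close> of the overview; \<open>Z_err\<close> is its \<open>V\<close>.
  Estimating the noise instead of the signal pays off because the noise has all moments, while
  \<open>X\<close> may have none.\<close>

definition Z_mean :: "real \<Rightarrow> 'a \<Rightarrow> real ^ 'n" where
  "Z_mean \<gamma> = (\<lambda>\<omega>. \<chi> i. real_cond_exp M (obs \<gamma>) (\<lambda>\<omega>'. Z \<omega>' $ i) \<omega>)"

definition Z_err :: "real \<Rightarrow> 'a \<Rightarrow> real ^ 'n" where
  "Z_err \<gamma> \<omega> = Z \<omega> - Z_mean \<gamma> \<omega>"

text \<open>The \<open>F\<close> of the overview as a function of the ratio \<gamma>.\<close>

definition sq_err :: "real \<Rightarrow> real" where
  "sq_err \<gamma> = expectation (\<lambda>\<omega>. (norm (Z_err \<gamma> \<omega>))\<^sup>2) / \<gamma>"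

lemma measurable_awgn [measurable]: "awgn X Z \<gamma> \<in> borel_measurable M"
  unfolding awgn_def by measurable

lemma measurable_awgn_obs [measurable]: "awgn X Z \<gamma> \<in> borel_measurable (obs \<gamma>)"
  unfolding obs_def by (rule measurable_vimage_algebra1) auto

lemma subalgebra_obs: "subalgebra M (obs \<gamma>)"
  unfolding subalgebra_def obs_def
  using sets_image_in_sets[OF _ measurable_awgn, of "space M"] by simp

lemma sigma_finite_obs: "sigma_finite_subalgebra M (obs \<gamma>)"
  by (intro finite_measure_subalgebra_is_sigma_finite finite_measure_subalgebra.intro
      finite_measure_subalgebra_axioms.intro finite_measure_axioms subalgebra_obs)

lemma measurable_obs: "f \<in> measurable (obs \<gamma>) N \<Longrightarrow> f \<in> measurable M N"
  by (rule measurable_from_subalg[OF subalgebra_obs])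

lemma Z_mean_nth: "Z_mean \<gamma> \<omega> $ i = real_cond_exp M (obs \<gamma>) (\<lambda>\<omega>'. Z \<omega>' $ i) \<omega>"
  by (simp add: Z_mean_def)

lemma measurable_Z_mean_obs [measurable]: "Z_mean \<gamma> \<in> borel_measurable (obs \<gamma>)"
  by (rule borel_measurable_vecI) (simp add: Z_mean_nth)

lemma measurable_Z_mean [measurable]: "Z_mean \<gamma> \<in> borel_measurable M"
  by (rule measurable_obs) measurable

lemma measurable_Z_err [measurable]: "Z_err \<gamma> \<in> borel_measurable M"
  unfolding Z_err_def[abs_def] by measurable

text \<open>The orthogonality principle: \<open>Z\<close> and its conditional mean have the same
  integral against an observable weight.\<close>

lemma Z_err_orthogonal:
  assumes g: "g \<in> borel_measurable (obs \<gamma>)" and int: "integrable M (\<lambda>\<omega>. g \<omega> * Z \<omega> $ i)"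
  shows "has_bochner_integral M (\<lambda>\<omega>. g \<omega> * Z_err \<gamma> \<omega> $ i) 0"
  using sigma_finite_subalgebra.real_cond_exp_intg[OF sigma_finite_obs int g] int
  by (auto simp: has_bochner_integral_iff Z_err_def Z_mean_nth right_diff_distrib)

text \<open>X itself need not be integrable: the weight \<open>1 / (1 + \<bar>Y\<bar>)\<close> makes both sides integrable and
  is then divided out again.\<close>
lemma cond_mean_eq:
  assumes \<gamma>: "\<gamma> > 0"
  shows "AE \<omega> in M. cond_mean M X (awgn X Z \<gamma>) \<omega>
    = (1 / sqrt \<gamma>) *\<^sub>R (awgn X Z \<gamma> \<omega> - Z_mean \<gamma> \<omega>)"
proof -
  have "AE \<omega> in M. real_cond_exp M (obs \<gamma>) (\<lambda>\<omega>. X \<omega> $ i) \<omega>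
      = (awgn X Z \<gamma> \<omega> $ i - real_cond_exp M (obs \<gamma>) (\<lambda>\<omega>. Z \<omega> $ i) \<omega>) / sqrt \<gamma>" for i
  proof -
    define f where "f = (\<lambda>\<omega>. 1 / (1 + \<bar>awgn X Z \<gamma> \<omega> $ i\<bar>))"
    define y where "y = (\<lambda>\<omega>. f \<omega> * awgn X Z \<gamma> \<omega> $ i)"
    have f_obs [measurable]: "f \<in> borel_measurable (obs \<gamma>)" unfolding f_def by measurable
    have y_obs [measurable]: "y \<in> borel_measurable (obs \<gamma>)" unfolding y_def by measurable
    have [measurable]: "f \<in> borel_measurable M" "y \<in> borel_measurable M"
      by (rule measurable_obs[OF f_obs], rule measurable_obs[OF y_obs])
    have f: "0 < f \<omega>" "f \<omega> \<le> 1" for \<omega> by (auto simp: f_def)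
    have y: "integrable M y"
      by (rule integrable_const_bound[of _ 1]) (auto simp: y_def f_def abs_mult)
    have fZ: "integrable M (\<lambda>\<omega>. f \<omega> * Z \<omega> $ i)"
      by (rule Bochner_Integration.integrable_bound[OF integrable_Z[of i]])
        (auto simp: abs_mult mult_left_le_one_le less_imp_le f)
    have X: "f \<omega> * X \<omega> $ i = (y \<omega> - f \<omega> * Z \<omega> $ i) / sqrt \<gamma>" for \<omega>
      using \<gamma> by (simp add: y_def awgn_def field_simps)
    have fX: "integrable M (\<lambda>\<omega>. f \<omega> * X \<omega> $ i)" unfolding X using y fZ by simp
    \<comment> \<open>Pulling out the observable weight requires integrability of the weighted
      product only.\<close>
    have "AE \<omega> in M. real_cond_exp M (obs \<gamma>) (\<lambda>\<omega>. f \<omega> * X \<omega> $ i) \<omega>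
        = f \<omega> * real_cond_exp M (obs \<gamma>) (\<lambda>\<omega>. X \<omega> $ i) \<omega>"
      by (rule sigma_finite_subalgebra.real_cond_exp_mult[OF sigma_finite_obs f_obs _ fX]) measurable
    moreover have "AE \<omega> in M. real_cond_exp M (obs \<gamma>) (\<lambda>\<omega>. f \<omega> * Z \<omega> $ i) \<omega>
        = f \<omega> * real_cond_exp M (obs \<gamma>) (\<lambda>\<omega>. Z \<omega> $ i) \<omega>"
      by (rule sigma_finite_subalgebra.real_cond_exp_mult[OF sigma_finite_obs f_obs _ fZ]) measurable
    moreover have "AE \<omega> in M. real_cond_exp M (obs \<gamma>) (\<lambda>\<omega>. f \<omega> * X \<omega> $ i) \<omega>
        = real_cond_exp M (obs \<gamma>) (\<lambda>\<omega>. y \<omega> - f \<omega> * Z \<omega> $ i) \<omega> / sqrt \<gamma>"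
      unfolding X using y fZ by (intro sigma_finite_subalgebra.real_cond_exp_cdiv[OF sigma_finite_obs]) simp
    moreover have "AE \<omega> in M. real_cond_exp M (obs \<gamma>) (\<lambda>\<omega>. y \<omega> - f \<omega> * Z \<omega> $ i) \<omega>
        = real_cond_exp M (obs \<gamma>) y \<omega> - real_cond_exp M (obs \<gamma>) (\<lambda>\<omega>. f \<omega> * Z \<omega> $ i) \<omega>"
      using y fZ by (rule sigma_finite_subalgebra.real_cond_exp_diff[OF sigma_finite_obs])
    moreover have "AE \<omega> in M. real_cond_exp M (obs \<gamma>) y \<omega> = y \<omega>"
      using y y_obs by (rule sigma_finite_subalgebra.real_cond_exp_F_meas[OF sigma_finite_obs])
    ultimately show ?thesis
    proof eventually_elim
      case (elim \<omega>)
      then have "f \<omega> * real_cond_exp M (obs \<gamma>) (\<lambda>\<omega>. X \<omega> $ i) \<omega>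
        = f \<omega> * ((awgn X Z \<gamma> \<omega> $ i - real_cond_exp M (obs \<gamma>) (\<lambda>\<omega>. Z \<omega> $ i) \<omega>) / sqrt \<gamma>)"
        by (simp add: y_def right_diff_distrib)
      then show ?case using f(1)[of \<omega>] unfolding mult_left_cancel[OF less_imp_neq[OF f(1), symmetric]] by simp
    qed
  qed
  then have "AE \<omega> in M. \<forall>i. real_cond_exp M (obs \<gamma>) (\<lambda>\<omega>. X \<omega> $ i) \<omega>
      = (awgn X Z \<gamma> \<omega> $ i - real_cond_exp M (obs \<gamma>) (\<lambda>\<omega>. Z \<omega> $ i) \<omega>) / sqrt \<gamma>"
    by (simp add: AE_all_countable)
  then show ?thesis
    by eventually_elim (simp add: cond_mean_def vec_eq_iff obs_def[symmetric] Z_mean_nth)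
qed

section \<open>Fourth moment bounds uniform in the ratio, and the link to the mmse\<close>

text \<open>Conditional Jensen for the convex function \<open>x ^ 4\<close>: averaging cannot raise
  the fourth moment, which is 3 for the noise. The bound does not depend on \<gamma>, which later
  keeps the remainder uniform.\<close>

lemma integrable_Z_mean4: "integrable M (\<lambda>\<omega>. (Z_mean \<gamma> \<omega> $ i) ^ 4)"
  and expectation_Z_mean4: "expectation (\<lambda>\<omega>. (Z_mean \<gamma> \<omega> $ i) ^ 4) \<le> 3"
proof -
  have conv: "convex_on UNIV (\<lambda>x :: real. x ^ 4)" by (rule convex_power_even) simp
  show int: "integrable M (\<lambda>\<omega>. (Z_mean \<gamma> \<omega> $ i) ^ 4)"
    unfolding Z_mean_nth
    by (rule sigma_finite_subalgebra.integrable_convex_cond_exp[OF sigma_finite_obs integrable_Z _ _ integrable_Z4(1) conv]) auto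
  have "AE \<omega> in M. (Z_mean \<gamma> \<omega> $ i) ^ 4 \<le> real_cond_exp M (obs \<gamma>) (\<lambda>\<omega>. (Z \<omega> $ i) ^ 4) \<omega>"
    unfolding Z_mean_nth
    by (rule sigma_finite_subalgebra.real_cond_exp_jensens_inequality(2)[OF sigma_finite_obs integrable_Z _ _ integrable_Z4(1) conv]) auto
  then have "expectation (\<lambda>\<omega>. (Z_mean \<gamma> \<omega> $ i) ^ 4)
      \<le> expectation (real_cond_exp M (obs \<gamma>) (\<lambda>\<omega>. (Z \<omega> $ i) ^ 4))"
    by (intro integral_mono_AE int sigma_finite_subalgebra.real_cond_exp_int[OF sigma_finite_obs] integrable_Z4)
  also have "\<dots> = 3" using sigma_finite_subalgebra.real_cond_exp_int(2)[OF sigma_finite_obs integrable_Z4(1)] integrable_Z4(2) by simp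
  finally show "expectation (\<lambda>\<omega>. (Z_mean \<gamma> \<omega> $ i) ^ 4) \<le> 3" .
qed

lemma integrable_norm4_Z_mean: "integrable M (\<lambda>\<omega>. ((norm (Z_mean \<gamma> \<omega>))\<^sup>2)\<^sup>2)"
  and expectation_norm4_Z_mean:
    "expectation (\<lambda>\<omega>. ((norm (Z_mean \<gamma> \<omega>))\<^sup>2)\<^sup>2) \<le> 3 * (real CARD('n))\<^sup>2"
proof -
  have int: "integrable M (\<lambda>\<omega>. real CARD('n) * (\<Sum>i\<in>UNIV. (Z_mean \<gamma> \<omega> $ i) ^ 4))"
    by (intro integrable_mult_right Bochner_Integration.integrable_sum integrable_Z_mean4)
  show 1: "integrable M (\<lambda>\<omega>. ((norm (Z_mean \<gamma> \<omega>))\<^sup>2)\<^sup>2)"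
    by (rule integrable_of_nonneg_le[OF int _ _ norm4_le_vec]) auto
  have "expectation (\<lambda>\<omega>. ((norm (Z_mean \<gamma> \<omega>))\<^sup>2)\<^sup>2)
      \<le> expectation (\<lambda>\<omega>. real CARD('n) * (\<Sum>i\<in>UNIV. (Z_mean \<gamma> \<omega> $ i) ^ 4))"
    by (intro integral_mono 1 int norm4_le_vec)
  also have "\<dots> = real CARD('n) * (\<Sum>i\<in>UNIV. expectation (\<lambda>\<omega>. (Z_mean \<gamma> \<omega> $ i) ^ 4))"
    by (simp add: integrable_Z_mean4)
  also have "\<dots> \<le> real CARD('n) * (\<Sum>i\<in>(UNIV :: 'n set). 3)"
    by (intro mult_left_mono sum_mono expectation_Z_mean4) auto
  finally show "expectation (\<lambda>\<omega>. ((norm (Z_mean \<gamma> \<omega>))\<^sup>2)\<^sup>2) \<le> 3 * (real CARD('n))\<^sup>2"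
    by (simp add: power2_eq_square)
qed

text \<open>From \<open>V = Z - m\<close> by using
  \<open>(p + q)\<^sup>2 \<le> 2 * (p\<^sup>2 + q\<^sup>2)\<close> twice; the first factor 2 gets
  squared, which makes 8.\<close>

lemma integrable_norm4_Z_err: "integrable M (\<lambda>\<omega>. ((norm (Z_err \<gamma> \<omega>))\<^sup>2)\<^sup>2)"
  and expectation_norm4_Z_err: "expectation (\<lambda>\<omega>. ((norm (Z_err \<gamma> \<omega>))\<^sup>2)\<^sup>2)
    \<le> 8 * (real CARD('n) * (real CARD('n) + 2) + 3 * (real CARD('n))\<^sup>2)"
proof -
  note Z = moment_norm4_Z[unfolded has_bochner_integral_iff]
  have bd: "((norm (Z_err \<gamma> \<omega>))\<^sup>2)\<^sup>2 \<le> 8 * (((norm (Z \<omega>))\<^sup>2)\<^sup>2 + ((norm (Z_mean \<gamma> \<omega>))\<^sup>2)\<^sup>2)" for \<omega>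
  proof -
    have sq: "(p + q)\<^sup>2 \<le> 2 * (p\<^sup>2 + q\<^sup>2)" for p q :: real
      using sum_squares_bound[of p q] by (simp add: power2_sum)
    have sq4: "(2 * (p + q))\<^sup>2 \<le> 8 * (p\<^sup>2 + q\<^sup>2)" for p q :: real
      using sq[of p q] by (simp add: power2_eq_square algebra_simps)
    have "(norm (Z_err \<gamma> \<omega>))\<^sup>2 \<le> (norm (Z \<omega>) + norm (Z_mean \<gamma> \<omega>))\<^sup>2"
      unfolding Z_err_def by (intro power_mono norm_triangle_ineq4) auto
    also have "\<dots> \<le> 2 * ((norm (Z \<omega>))\<^sup>2 + (norm (Z_mean \<gamma> \<omega>))\<^sup>2)" by (rule sq)
    finally have "((norm (Z_err \<gamma> \<omega>))\<^sup>2)\<^sup>2 \<le> (2 * ((norm (Z \<omega>))\<^sup>2 + (norm (Z_mean \<gamma> \<omega>))\<^sup>2))\<^sup>2"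
      by (intro power_mono) auto
    also have "\<dots> \<le> 8 * (((norm (Z \<omega>))\<^sup>2)\<^sup>2 + ((norm (Z_mean \<gamma> \<omega>))\<^sup>2)\<^sup>2)"
      by (rule sq4)
    finally show ?thesis .
  qed
  have int: "integrable M (\<lambda>\<omega>. 8 * (((norm (Z \<omega>))\<^sup>2)\<^sup>2 + ((norm (Z_mean \<gamma> \<omega>))\<^sup>2)\<^sup>2))"
    using Z integrable_norm4_Z_mean by simp
  show 1: "integrable M (\<lambda>\<omega>. ((norm (Z_err \<gamma> \<omega>))\<^sup>2)\<^sup>2)"
    by (rule integrable_of_nonneg_le[OF int _ _ bd]) auto
  have "expectation (\<lambda>\<omega>. ((norm (Z_err \<gamma> \<omega>))\<^sup>2)\<^sup>2)
      \<le> expectation (\<lambda>\<omega>. 8 * (((norm (Z \<omega>))\<^sup>2)\<^sup>2 + ((norm (Z_mean \<gamma> \<omega>))\<^sup>2)\<^sup>2))"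
    by (intro integral_mono 1 int bd)
  also have "\<dots> = 8 * (real CARD('n) * (real CARD('n) + 2) + expectation (\<lambda>\<omega>. ((norm (Z_mean \<gamma> \<omega>))\<^sup>2)\<^sup>2))"
    using Z integrable_norm4_Z_mean[of \<gamma>] by (simp del: power_mult)
  also have "\<dots> \<le> 8 * (real CARD('n) * (real CARD('n) + 2) + 3 * (real CARD('n))\<^sup>2)"
    by (intro mult_left_mono add_left_mono expectation_norm4_Z_mean) auto
  finally show "expectation (\<lambda>\<omega>. ((norm (Z_err \<gamma> \<omega>))\<^sup>2)\<^sup>2)
    \<le> 8 * (real CARD('n) * (real CARD('n) + 2) + 3 * (real CARD('n))\<^sup>2)" .
qed

lemma integrable_norm2_Z_err: "integrable M (\<lambda>\<omega>. (norm (Z_err \<gamma> \<omega>))\<^sup>2)"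
  by (rule square_integrable_imp_integrable[OF _ integrable_norm4_Z_err]) measurable

lemma integrable_norm2_Z_mean: "integrable M (\<lambda>\<omega>. (norm (Z_mean \<gamma> \<omega>))\<^sup>2)"
  by (rule square_integrable_imp_integrable[OF _ integrable_norm4_Z_mean]) measurable

lemma integrable_Z_err2: "integrable M (\<lambda>\<omega>. (Z_err \<gamma> \<omega> $ i)\<^sup>2)"
proof (rule integrable_of_nonneg_le[OF integrable_norm2_Z_err])
  show "(Z_err \<gamma> \<omega> $ i)\<^sup>2 \<le> (norm (Z_err \<gamma> \<omega>))\<^sup>2" for \<omega>
    by (auto simp: norm_power2_vec intro!: member_le_sum)
qed auto

text \<open>By \<open>cond_mean_eq\<close> the estimation error of \<open>X\<close> is almost surely
  \<open>- V / sqrt \<gamma>\<close>. Its products of entries are integrable, so averaging the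
  conditional covariance removes the conditioning.\<close>

lemma mmse_eq_sq_err:
  assumes \<gamma>: "\<gamma> > 0"
  shows "mmse M X Z \<gamma> = sq_err \<gamma> / real CARD('n)"
proof -
  define U where "U = (\<lambda>\<omega>. X \<omega> - cond_mean M X (awgn X Z \<gamma>) \<omega>)"
  have cm: "cond_mean M X (awgn X Z \<gamma>) \<omega> $ i = real_cond_exp M (obs \<gamma>) (\<lambda>\<omega>. X \<omega> $ i) \<omega>" for \<omega> i
    by (simp add: cond_mean_def obs_def)
  have [measurable]: "U \<in> borel_measurable M"
    unfolding U_def by (rule borel_measurable_vecI) (simp add: cm)
  have "AE \<omega> in M. U \<omega> = (- 1 / sqrt \<gamma>) *\<^sub>R Z_err \<gamma> \<omega>"
    using cond_mean_eq[OF \<gamma>]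
    by eventually_elim (use \<gamma> in \<open>simp add: U_def Z_err_def awgn_def scaleR_right_distrib scaleR_right_diff_distrib\<close>)
  then have U: "AE \<omega> in M. Z_err \<gamma> \<omega> $ i * Z_err \<gamma> \<omega> $ j / \<gamma> = outer (U \<omega>) $ i $ j" for i j
    by eventually_elim (use \<gamma> in \<open>simp add: outer_nth\<close>)
  have int: "integrable M (\<lambda>\<omega>. Z_err \<gamma> \<omega> $ i * Z_err \<gamma> \<omega> $ j / \<gamma>)" for i j
    by (intro integrable_divide integrable_mult_squares integrable_Z_err2) measurable
  have outer_meas: "(\<lambda>\<omega>. outer (U \<omega>) $ i $ j) \<in> borel_measurable M" for i j
    unfolding outer_nth by measurable
  \<comment> \<open>Integrability is carried over from the noise error along the almost sure
    equality, as \<open>X\<close> itself may lack moments.\<close>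
  have outer_int: "integrable M (\<lambda>\<omega>. outer (U \<omega>) $ i $ j)" for i j
    using int[of i j] U[of i j] outer_meas[of i j]
    by (subst (asm) integrable_cong_AE) auto
  have "trace (integral\<^sup>L M (cond_cov M X (awgn X Z \<gamma>)))
      = (\<Sum>i\<in>UNIV. expectation (real_cond_exp M (obs \<gamma>) (\<lambda>\<omega>. outer (U \<omega>) $ i $ i)))"
    unfolding trace_def cond_cov_def obs_def[symmetric] U_def[symmetric, abs_def]
    using outer_int
    by (subst integral_matrix_nth)
      (auto simp: U_def intro: sigma_finite_subalgebra.real_cond_exp_int[OF sigma_finite_obs])
  also have "\<dots> = (\<Sum>i\<in>UNIV. expectation (\<lambda>\<omega>. Z_err \<gamma> \<omega> $ i * Z_err \<gamma> \<omega> $ i / \<gamma>))"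
  proof (intro sum.cong refl)
    fix i
    have "expectation (real_cond_exp M (obs \<gamma>) (\<lambda>\<omega>. outer (U \<omega>) $ i $ i))
        = expectation (\<lambda>\<omega>. outer (U \<omega>) $ i $ i)"
      by (rule sigma_finite_subalgebra.real_cond_exp_int(2)[OF sigma_finite_obs outer_int])
    also have "\<dots> = expectation (\<lambda>\<omega>. Z_err \<gamma> \<omega> $ i * Z_err \<gamma> \<omega> $ i / \<gamma>)"
      by (rule integral_cong_AE[symmetric]) (use U outer_meas in auto)
    finally show "expectation (real_cond_exp M (obs \<gamma>) (\<lambda>\<omega>. outer (U \<omega>) $ i $ i))
        = expectation (\<lambda>\<omega>. Z_err \<gamma> \<omega> $ i * Z_err \<gamma> \<omega> $ i / \<gamma>)" .
  qed
  also have "\<dots> = expectation (\<lambda>\<omega>. \<Sum>i\<in>UNIV. Z_err \<gamma> \<omega> $ i * Z_err \<gamma> \<omega> $ i / \<gamma>)"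
    by (rule Bochner_Integration.integral_sum[symmetric]) (rule int)
  also have "\<dots> = sq_err \<gamma>"
    by (simp add: sq_err_def norm_power2_vec power2_eq_square[of "_ $ _"] flip: sum_divide_distrib)
  finally show ?thesis unfolding mmse_def by simp
qed

section \<open>Growth of the estimation error\<close>

lemma mean_inner_err_zero: "has_bochner_integral M (\<lambda>\<omega>. Z_mean \<gamma> \<omega> \<bullet> Z_err \<gamma> \<omega>) 0"
proof -
  have "has_bochner_integral M (\<lambda>\<omega>. Z_mean \<gamma> \<omega> $ i * Z_err \<gamma> \<omega> $ i) 0" for i
  proof (rule Z_err_orthogonal)
    show "integrable M (\<lambda>\<omega>. Z_mean \<gamma> \<omega> $ i * Z \<omega> $ i)"
    proof (rule integrable_mult_squares)
      show "integrable M (\<lambda>\<omega>. (Z_mean \<gamma> \<omega> $ i)\<^sup>2)"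
        by (rule square_integrable_imp_integrable)
          (use integrable_Z_mean4 in \<open>auto simp flip: power_mult\<close>)
      show "integrable M (\<lambda>\<omega>. (Z \<omega> $ i)\<^sup>2)"
        using moment_Z2 unfolding has_bochner_integral_iff by blast
    qed measurable
  qed measurable
  then have "has_bochner_integral M (\<lambda>\<omega>. \<Sum>i\<in>UNIV. Z_mean \<gamma> \<omega> $ i * Z_err \<gamma> \<omega> $ i) (\<Sum>i\<in>(UNIV :: 'n set). 0)"
    by (intro has_bochner_integral_sum)
  then show ?thesis by (simp add: inner_vec_def)
qed

text \<open>\<open>|m|^2 m\<close> is observable, so orthogonality applies in each coordinate;
  integrability of the fourth-degree product follows by bounding products by squares twice. This
  disposes of the term of indefinite sign in the growth rate.\<close>

lemma norm2_mean_inner_err_zero: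
  "has_bochner_integral M (\<lambda>\<omega>. (Z_mean \<gamma> \<omega> \<bullet> Z_err \<gamma> \<omega>) * (norm (Z_mean \<gamma> \<omega>))\<^sup>2) 0"
proof -
  have "has_bochner_integral M (\<lambda>\<omega>. ((norm (Z_mean \<gamma> \<omega>))\<^sup>2 * Z_mean \<gamma> \<omega> $ i) * Z_err \<gamma> \<omega> $ i) 0" for i
  proof (rule Z_err_orthogonal)
    have "integrable M (\<lambda>\<omega>. (Z_mean \<gamma> \<omega> $ i)\<^sup>2 * (Z \<omega> $ i)\<^sup>2)"
      by (rule integrable_mult_squares)
        (use integrable_Z_mean4 integrable_Z4(1) in \<open>auto simp flip: power_mult\<close>)
    then have "integrable M (\<lambda>\<omega>. (Z_mean \<gamma> \<omega> $ i * Z \<omega> $ i)\<^sup>2)"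
      by (simp add: power_mult_distrib)
    then have "integrable M (\<lambda>\<omega>. (norm (Z_mean \<gamma> \<omega>))\<^sup>2 * (Z_mean \<gamma> \<omega> $ i * Z \<omega> $ i))"
      by (intro integrable_mult_squares integrable_norm4_Z_mean) auto
    then show "integrable M (\<lambda>\<omega>. ((norm (Z_mean \<gamma> \<omega>))\<^sup>2 * Z_mean \<gamma> \<omega> $ i) * Z \<omega> $ i)"
      by (simp add: mult.assoc)
  qed measurable
  then have "has_bochner_integral M (\<lambda>\<omega>. \<Sum>i\<in>UNIV. ((norm (Z_mean \<gamma> \<omega>))\<^sup>2 * Z_mean \<gamma> \<omega> $ i) * Z_err \<gamma> \<omega> $ i)
      (\<Sum>i\<in>(UNIV :: 'n set). 0)"
    by (intro has_bochner_integral_sum)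
  moreover have "(\<Sum>i\<in>UNIV. ((norm (Z_mean \<gamma> \<omega>))\<^sup>2 * Z_mean \<gamma> \<omega> $ i) * Z_err \<gamma> \<omega> $ i)
      = (Z_mean \<gamma> \<omega> \<bullet> Z_err \<gamma> \<omega>) * (norm (Z_mean \<gamma> \<omega>))\<^sup>2" for \<omega>
    by (simp add: inner_vec_def sum_distrib_left mult.assoc mult.commute[of _ "(norm _)\<^sup>2"])
  ultimately show ?thesis by simp
qed

lemma norm2_Z_eq:
  "(norm (Z \<omega>))\<^sup>2 = (norm (Z_err \<gamma> \<omega>))\<^sup>2 + 2 * (Z_mean \<gamma> \<omega> \<bullet> Z_err \<gamma> \<omega>) + (norm (Z_mean \<gamma> \<omega>))\<^sup>2"
proof -
  have "(norm (m + e))\<^sup>2 = (norm e)\<^sup>2 + 2 * (m \<bullet> e) + (norm m)\<^sup>2" for m e :: "real ^ 'n"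
    by (simp add: power2_norm_eq_inner inner_add inner_commute)
  from this[of "Z_mean \<gamma> \<omega>" "Z_err \<gamma> \<omega>"] show ?thesis
    by (simp only: Z_err_def) simp
qed

lemma integrable_err2_Z2: "integrable M (\<lambda>\<omega>. (norm (Z_err \<gamma> \<omega>))\<^sup>2 * (norm (Z \<omega>))\<^sup>2)"
  by (rule integrable_mult_squares)
    (use integrable_norm4_Z_err moment_norm4_Z in \<open>auto simp: has_bochner_integral_iff\<close>)

text \<open>This integrates \<open>sum_mult_mean_square_le\<close>: the mixed term has mean zero,
  and the right-hand side becomes the fourth moment of the noise.\<close>

lemma weighted_err_le:
  "expectation (\<lambda>\<omega>. (norm (Z_err \<gamma> \<omega>))\<^sup>2 * (norm (Z \<omega>))\<^sup>2) / 2
    \<le> real CARD('n) * (real CARD('n) + 2) - expectation (\<lambda>\<omega>. ((norm (Z_mean \<gamma> \<omega>))\<^sup>2)\<^sup>2)"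
proof -
  let ?a = "\<lambda>\<omega>. (norm (Z_err \<gamma> \<omega>))\<^sup>2" and ?b = "\<lambda>\<omega>. Z_mean \<gamma> \<omega> \<bullet> Z_err \<gamma> \<omega>"
    and ?c = "\<lambda>\<omega>. (norm (Z_mean \<gamma> \<omega>))\<^sup>2" and ?z = "\<lambda>\<omega>. (norm (Z \<omega>))\<^sup>2"
  note z = moment_norm4_Z[unfolded has_bochner_integral_iff]
    and bc = norm2_mean_inner_err_zero[of \<gamma>, unfolded has_bochner_integral_iff]
  have "expectation (\<lambda>\<omega>. ?a \<omega> * ?z \<omega> / 2 + (?c \<omega>)\<^sup>2 + 4 * (?b \<omega> * ?c \<omega>))
      \<le> expectation (\<lambda>\<omega>. (?z \<omega>)\<^sup>2)"
  proof (rule integral_mono)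
    show "integrable M (\<lambda>\<omega>. ?a \<omega> * ?z \<omega> / 2 + (?c \<omega>)\<^sup>2 + 4 * (?b \<omega> * ?c \<omega>))"
      by (intro Bochner_Integration.integrable_add integrable_divide integrable_mult_right
          integrable_err2_Z2 integrable_norm4_Z_mean conjunct1[OF bc])
    show "integrable M (\<lambda>\<omega>. (?z \<omega>)\<^sup>2)" using z by blast
    show "?a \<omega> * ?z \<omega> / 2 + (?c \<omega>)\<^sup>2 + 4 * (?b \<omega> * ?c \<omega>) \<le> (?z \<omega>)\<^sup>2" for \<omega>
      unfolding norm2_Z_eq[of \<omega> \<gamma>]
      using Cauchy_Schwarz_ineq[of "Z_mean \<gamma> \<omega>" "Z_err \<gamma> \<omega>"]
      by (intro sum_mult_mean_square_le) (auto simp: power2_norm_eq_inner mult.commute)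
  qed
  also have "expectation (\<lambda>\<omega>. ?a \<omega> * ?z \<omega> / 2 + (?c \<omega>)\<^sup>2 + 4 * (?b \<omega> * ?c \<omega>))
      = expectation (\<lambda>\<omega>. ?a \<omega> * ?z \<omega>) / 2 + expectation (\<lambda>\<omega>. (?c \<omega>)\<^sup>2)
        + 4 * expectation (\<lambda>\<omega>. ?b \<omega> * ?c \<omega>)"
    using integrable_err2_Z2[of \<gamma>] integrable_norm4_Z_mean[of \<gamma>] conjunct1[OF bc] by simp
  finally show ?thesis using z bc by simp
qed

text \<open>Pythagoras: \<open>m\<close> and \<open>V\<close> are orthogonal in mean, and the
  squared norm of \<open>Z\<close> has mean n.\<close>

lemma mean2_eq: "expectation (\<lambda>\<omega>. (norm (Z_mean \<gamma> \<omega>))\<^sup>2)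
    = real CARD('n) - expectation (\<lambda>\<omega>. (norm (Z_err \<gamma> \<omega>))\<^sup>2)"
proof -
  have "expectation (\<lambda>\<omega>. (norm (Z \<omega>))\<^sup>2) = expectation (\<lambda>\<omega>. (norm (Z_err \<gamma> \<omega>))\<^sup>2)
      + 2 * expectation (\<lambda>\<omega>. Z_mean \<gamma> \<omega> \<bullet> Z_err \<gamma> \<omega>) + expectation (\<lambda>\<omega>. (norm (Z_mean \<gamma> \<omega>))\<^sup>2)"
    unfolding norm2_Z_eq[of _ \<gamma>]
    using integrable_norm2_Z_err[of \<gamma>] integrable_norm2_Z_mean[of \<gamma>] mean_inner_err_zero[of \<gamma>]
    by (simp add: has_bochner_integral_iff)
  then show ?thesis
    using moment_norm2_Z mean_inner_err_zero[of \<gamma>] by (simp add: has_bochner_integral_iff)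
qed

section \<open>Comparison with other estimators and the one-step bound\<close>

text \<open>The error of \<open>g\<close> differs from the optimal error by an observable vector, to
  which the optimal error is orthogonal. The risk of \<open>g\<close> is an \<open>ennreal\<close>,
  since it may be infinite, in which case nothing is to be shown.\<close>

lemma sq_err_le_estimator:
  assumes \<gamma>: "\<gamma> > 0" and [measurable]: "g \<in> borel_measurable borel"
  shows "ennreal (sq_err \<gamma>) \<le> (\<integral>\<^sup>+\<omega>. ennreal ((norm (X \<omega> - g (awgn X Z \<gamma> \<omega>)))\<^sup>2) \<partial>M)"
proof (cases "(\<integral>\<^sup>+\<omega>. ennreal ((norm (X \<omega> - g (awgn X Z \<gamma> \<omega>)))\<^sup>2) \<partial>M) = \<infinity>")
  case False
  define D where "D = (\<lambda>\<omega>. X \<omega> - g (awgn X Z \<gamma> \<omega>))"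
  define E where "E = (\<lambda>\<omega>. (1 / sqrt \<gamma>) *\<^sub>R Z_err \<gamma> \<omega>)"
  define d where "d = (\<lambda>\<omega>. (1 / sqrt \<gamma>) *\<^sub>R (awgn X Z \<gamma> \<omega> - Z_mean \<gamma> \<omega>) - g (awgn X Z \<gamma> \<omega>))"
  have DE: "D \<omega> = d \<omega> - E \<omega>" for \<omega>
    using \<gamma> by (simp add: D_def E_def d_def Z_err_def awgn_def scaleR_right_diff_distrib scaleR_right_distrib)
  have d_obs [measurable]: "d \<in> borel_measurable (obs \<gamma>)" unfolding d_def by measurable
  have [measurable]: "D \<in> borel_measurable M" "E \<in> borel_measurable M" unfolding D_def E_def by measurable
  have [measurable]: "d \<in> borel_measurable M" by (rule measurable_obs[OF d_obs])
  have D: "integrable M (\<lambda>\<omega>. (norm (D \<omega>))\<^sup>2)"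
    using False by (intro integrableI_bounded) (auto simp: D_def less_top[symmetric])
  have E2: "(norm (E \<omega>))\<^sup>2 = (norm (Z_err \<gamma> \<omega>))\<^sup>2 / \<gamma>" for \<omega>
    using \<gamma> by (simp add: E_def power_divide)
  have E: "integrable M (\<lambda>\<omega>. (norm (E \<omega>))\<^sup>2)" "expectation (\<lambda>\<omega>. (norm (E \<omega>))\<^sup>2) = sq_err \<gamma>"
    unfolding E2 sq_err_def using integrable_norm2_Z_err[of \<gamma>] by simp_all
  \<comment> \<open>The gap \<open>d\<close> between the two estimators is square integrable because
    both errors are, even if neither estimator is.\<close>
  have d: "integrable M (\<lambda>\<omega>. (norm (d \<omega>))\<^sup>2)"
  proof (rule integrable_of_nonneg_le)
    show "integrable M (\<lambda>\<omega>. 2 * ((norm (D \<omega>))\<^sup>2 + (norm (E \<omega>))\<^sup>2))" using D E by simp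
    show "(norm (d \<omega>))\<^sup>2 \<le> 2 * ((norm (D \<omega>))\<^sup>2 + (norm (E \<omega>))\<^sup>2)" for \<omega>
    proof -
      have "norm (d \<omega>) \<le> norm (D \<omega>) + norm (E \<omega>)"
        using norm_triangle_ineq[of "D \<omega>" "E \<omega>"] by (simp add: DE)
      then have "(norm (d \<omega>))\<^sup>2 \<le> (norm (D \<omega>) + norm (E \<omega>))\<^sup>2" by (intro power_mono) auto
      then show ?thesis using sum_squares_bound[of "norm (D \<omega>)" "norm (E \<omega>)"] by (simp add: power2_sum)
    qed
  qed auto
  have comp: "integrable M (\<lambda>\<omega>. (d \<omega> $ i)\<^sup>2)" for i
    by (rule integrable_of_nonneg_le[OF d]) (auto simp: norm_power2_vec intro!: member_le_sum)
  have "has_bochner_integral M (\<lambda>\<omega>. d \<omega> $ i * Z_err \<gamma> \<omega> $ i) 0" for i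
    by (intro Z_err_orthogonal integrable_mult_squares comp)
      (use moment_Z2 in \<open>auto simp: has_bochner_integral_iff\<close>)
  then have "has_bochner_integral M (\<lambda>\<omega>. \<Sum>i\<in>UNIV. d \<omega> $ i * Z_err \<gamma> \<omega> $ i) (\<Sum>i\<in>(UNIV :: 'n set). 0)"
    by (intro has_bochner_integral_sum)
  then have "has_bochner_integral M (\<lambda>\<omega>. (1 / sqrt \<gamma>) * (\<Sum>i\<in>UNIV. d \<omega> $ i * Z_err \<gamma> \<omega> $ i)) ((1 / sqrt \<gamma>) * 0)"
    by (intro has_bochner_integral_mult_right) simp
  moreover have "(1 / sqrt \<gamma>) * (\<Sum>i\<in>UNIV. d \<omega> $ i * Z_err \<gamma> \<omega> $ i) = d \<omega> \<bullet> E \<omega>" for \<omega>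
    by (simp add: inner_vec_def E_def sum_divide_distrib)
  ultimately have dE: "has_bochner_integral M (\<lambda>\<omega>. d \<omega> \<bullet> E \<omega>) 0" by simp
  have "(norm (D \<omega>))\<^sup>2 = (norm (d \<omega>))\<^sup>2 + (norm (E \<omega>))\<^sup>2 - 2 * (d \<omega> \<bullet> E \<omega>)" for \<omega>
    unfolding DE power2_norm_eq_inner by (simp add: inner_diff inner_commute)
  then have "expectation (\<lambda>\<omega>. (norm (D \<omega>))\<^sup>2) = expectation (\<lambda>\<omega>. (norm (d \<omega>))\<^sup>2) + sq_err \<gamma>"
    using d E dE by (simp add: has_bochner_integral_iff)
  moreover have "0 \<le> expectation (\<lambda>\<omega>. (norm (d \<omega>))\<^sup>2)" by simp
  ultimately have "sq_err \<gamma> \<le> expectation (\<lambda>\<omega>. (norm (D \<omega>))\<^sup>2)" by linarith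
  then have "ennreal (sq_err \<gamma>) \<le> ennreal (expectation (\<lambda>\<omega>. (norm (D \<omega>))\<^sup>2))" by (rule ennreal_leI)
  also have "\<dots> = (\<integral>\<^sup>+\<omega>. ennreal ((norm (D \<omega>))\<^sup>2) \<partial>M)"
    using D by (subst nn_integral_eq_integral) auto
  finally show ?thesis by (simp add: D_def)
qed simp

text \<open>One step of the comparison in the overview, in the variable u. The factor of
  \<open>(v - u)\<^sup>2 / u\<close> depends on the dimension only, so the steps can be
  summed.\<close>

lemma sq_err_increment_le:
  assumes u: "0 < u" "u \<le> v" "v - u \<le> u / 4"
  shows "sq_err (1 / v) - sq_err (1 / u)
    \<le> (v - u) * (real CARD('n) * (real CARD('n) + 2) - expectation (\<lambda>\<omega>. ((norm (Z_mean (1 / u) \<omega>))\<^sup>2)\<^sup>2))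
      + 64 * (8 * (real CARD('n) * (real CARD('n) + 2) + 3 * (real CARD('n))\<^sup>2) + 2 ^ CARD('n)) * (v - u)\<^sup>2 / u"
proof -
  define \<gamma> where "\<gamma> = 1 / u"
  define \<gamma>' where "\<gamma>' = 1 / v"
  \<comment> \<open>With this choice \<open>1 / v = \<gamma> / (1 + \<delta>)\<close>; scaling the
    observation at \<open>\<gamma>'\<close> by \<open>r\<close> restores the signal part
    \<open>sqrt \<gamma> X\<close> and leaves the noise \<open>r Z\<close>.\<close>
  define \<delta> where "\<delta> = (v - u) / u"
  define r where "r = sqrt (1 + \<delta>)"
  have pos: "\<gamma> > 0" "\<gamma>' > 0" using u by (auto simp: \<gamma>_def \<gamma>'_def)
  have \<delta>: "0 \<le> \<delta>" "\<delta> \<le> 1 / 4" using u by (auto simp: \<delta>_def field_simps)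
  have r: "r \<ge> 1" "r\<^sup>2 - 1 = \<delta>" using \<delta> by (auto simp: r_def)
  have r\<gamma>': "r * sqrt \<gamma>' = sqrt \<gamma>"
  proof -
    have "(1 + \<delta>) * \<gamma>' = \<gamma>" using u by (simp add: \<delta>_def \<gamma>_def \<gamma>'_def field_simps)
    then show ?thesis by (simp add: r_def flip: real_sqrt_mult)
  qed
  let ?a = "\<lambda>\<omega>. (norm (Z_err \<gamma> \<omega>))\<^sup>2" and ?z = "\<lambda>\<omega>. (norm (Z \<omega>))\<^sup>2"
    and ?e = "\<lambda>\<omega>. exp (3 * (norm (Z \<omega>))\<^sup>2 / 16)"
  \<comment> \<open>The optimal estimator at \<gamma> as a Borel function, ready to be fed an
    observation with stronger noise.\<close>
  obtain f where [measurable]: "f \<in> borel_measurable borel"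
    and f: "\<And>\<omega>. \<omega> \<in> space M \<Longrightarrow> (1 / sqrt \<gamma>) *\<^sub>R (awgn X Z \<gamma> \<omega> - Z_mean \<gamma> \<omega>) = f (awgn X Z \<gamma> \<omega>)"
  proof (rule measurable_vimage_algebra_factor_vec)
    show "(\<lambda>\<omega>. ((1 / sqrt \<gamma>) *\<^sub>R (awgn X Z \<gamma> \<omega> - Z_mean \<gamma> \<omega>)) $ i)
        \<in> borel_measurable (vimage_algebra (space M) (awgn X Z \<gamma>) borel)" for i
      unfolding obs_def[symmetric] by measurable
  qed auto
  define H where "H = (\<lambda>p :: (real ^ 'n) \<times> (real ^ 'n).
    ennreal ((norm (fst p - f (sqrt \<gamma> *\<^sub>R fst p + snd p)))\<^sup>2))"
  have [measurable]: "H \<in> borel_measurable (borel \<Otimes>\<^sub>M borel)" unfolding H_def by measurable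
  have H: "H (X \<omega>, Z \<omega>) = ennreal (?a \<omega> / \<gamma>)" if "\<omega> \<in> space M" for \<omega>
  proof -
    have "X \<omega> - f (sqrt \<gamma> *\<^sub>R X \<omega> + Z \<omega>) = - ((1 / sqrt \<gamma>) *\<^sub>R Z_err \<gamma> \<omega>)"
      using f[OF that, symmetric] pos
      by (simp add: awgn_def Z_err_def scaleR_right_diff_distrib scaleR_right_distrib)
    then show ?thesis using pos by (simp add: H_def power_divide)
  qed
  have int: "integrable M (\<lambda>\<omega>. ?a \<omega> * ?e \<omega>)"
    by (rule integrable_mult_squares)
      (use integrable_norm4_Z_err moment_exp_Z in \<open>auto simp: has_bochner_integral_iff\<close>)
  have ae: "2 * expectation (\<lambda>\<omega>. ?a \<omega> * ?e \<omega>) \<le> 8 * (real CARD('n) * (real CARD('n) + 2) + 3 * (real CARD('n))\<^sup>2) + 2 ^ CARD('n)"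
  proof -
    \<comment> \<open>The remainder is split by \<open>2ab \<le> a\<^sup>2 + b\<^sup>2\<close>, so
      the fourth moment of the error and \<open>moment_exp_Z\<close> suffice.\<close>
    have "2 * (?a \<omega> * ?e \<omega>) \<le> (?a \<omega>)\<^sup>2 + (?e \<omega>)\<^sup>2" for \<omega>
      using sum_squares_bound[of "?a \<omega>" "?e \<omega>"] by (simp add: mult.assoc)
    then have "expectation (\<lambda>\<omega>. 2 * (?a \<omega> * ?e \<omega>)) \<le> expectation (\<lambda>\<omega>. (?a \<omega>)\<^sup>2 + (?e \<omega>)\<^sup>2)"
      using moment_exp_Z unfolding has_bochner_integral_iff
      by (intro integral_mono integrable_mult_right Bochner_Integration.integrable_add
          int integrable_norm4_Z_err) blast+
    also have "\<dots> = expectation (\<lambda>\<omega>. (?a \<omega>)\<^sup>2) + 2 ^ CARD('n)"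
      using integrable_norm4_Z_err[of \<gamma>] moment_exp_Z
      by (simp add: has_bochner_integral_iff)
    also have "\<dots> \<le> 8 * (real CARD('n) * (real CARD('n) + 2) + 3 * (real CARD('n))\<^sup>2) + 2 ^ CARD('n)"
      using expectation_norm4_Z_err[of \<gamma>] by simp
    finally show ?thesis by simp
  qed
  let ?B = "\<lambda>\<omega>. (?a \<omega> + \<delta> / 2 * (?a \<omega> * ?z \<omega>) + 128 * \<delta>\<^sup>2 * (?a \<omega> * ?e \<omega>)) / \<gamma>"
  have B_int: "integrable M ?B"
    by (intro integrable_divide Bochner_Integration.integrable_add integrable_mult_right
        integrable_norm2_Z_err integrable_err2_Z2 int)
  have "ennreal (sq_err \<gamma>') \<le> (\<integral>\<^sup>+\<omega>. ennreal ((norm (X \<omega> - f (r *\<^sub>R awgn X Z \<gamma>' \<omega>)))\<^sup>2) \<partial>M)"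
    by (rule sq_err_le_estimator[OF pos(2), of "\<lambda>y. f (r *\<^sub>R y)"]) measurable
  also have "\<dots> = (\<integral>\<^sup>+\<omega>. H (X \<omega>, r *\<^sub>R Z \<omega>) \<partial>M)"
    by (simp add: H_def awgn_def scaleR_right_distrib r\<gamma>')
  also have "\<dots> \<le> (\<integral>\<^sup>+\<omega>. H (X \<omega>, Z \<omega>) * ennreal (exp ((r\<^sup>2 - 1) * ?z \<omega> / 2)) \<partial>M)"
    by (rule nn_integral_scale_noise_le) (use r in auto)
  also have "\<dots> \<le> (\<integral>\<^sup>+\<omega>. ennreal (?B \<omega>) \<partial>M)"
  proof (rule nn_integral_mono)
    fix \<omega> assume \<omega>: "\<omega> \<in> space M"
    have "?a \<omega> / \<gamma> * exp (\<delta> * ?z \<omega> / 2) \<le> ?a \<omega> / \<gamma> * (1 + \<delta> * ?z \<omega> / 2 + 128 * \<delta>\<^sup>2 * ?e \<omega>)"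
      using \<delta> pos by (intro mult_left_mono exp_le_quadratic_remainder) auto
    also have "\<dots> = ?B \<omega>" by (simp add: field_simps)
    finally show "H (X \<omega>, Z \<omega>) * ennreal (exp ((r\<^sup>2 - 1) * ?z \<omega> / 2)) \<le> ennreal (?B \<omega>)"
      unfolding H[OF \<omega>] r using pos by (subst ennreal_mult[symmetric]) (auto intro!: ennreal_leI)
  qed
  also have "\<dots> = ennreal (expectation ?B)"
    using B_int pos \<delta> by (intro nn_integral_eq_integral AE_I2) auto
  finally have "sq_err \<gamma>' \<le> expectation ?B"
    using pos \<delta> by (subst (asm) ennreal_le_iff) (auto intro!: Bochner_Integration.integral_nonneg)
  also have "expectation ?B = (expectation ?a + \<delta> / 2 * expectation (\<lambda>\<omega>. ?a \<omega> * ?z \<omega>)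
      + 128 * \<delta>\<^sup>2 * expectation (\<lambda>\<omega>. ?a \<omega> * ?e \<omega>)) / \<gamma>"
    using integrable_norm2_Z_err[of \<gamma>] integrable_err2_Z2[of \<gamma>] int by simp
  \<comment> \<open>Here \<open>\<delta> / \<gamma> = v - u\<close> and
    \<open>\<delta>\<^sup>2 / \<gamma> = (v - u)\<^sup>2 / u\<close>.\<close>
  also have "\<dots> = sq_err \<gamma> + (v - u) * (expectation (\<lambda>\<omega>. ?a \<omega> * ?z \<omega>) / 2)
      + 64 * (2 * expectation (\<lambda>\<omega>. ?a \<omega> * ?e \<omega>)) * (v - u)\<^sup>2 / u"
    using u by (simp add: sq_err_def \<delta>_def \<gamma>_def field_simps power2_eq_square)
  finally have "sq_err \<gamma>' - sq_err \<gamma> \<le> (v - u) * (expectation (\<lambda>\<omega>. ?a \<omega> * ?z \<omega>) / 2)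
      + 64 * (2 * expectation (\<lambda>\<omega>. ?a \<omega> * ?e \<omega>)) * (v - u)\<^sup>2 / u" by linarith
  also have "\<dots> \<le> (v - u) * (real CARD('n) * (real CARD('n) + 2) - expectation (\<lambda>\<omega>. ((norm (Z_mean \<gamma> \<omega>))\<^sup>2)\<^sup>2))
      + 64 * (8 * (real CARD('n) * (real CARD('n) + 2) + 3 * (real CARD('n))\<^sup>2) + 2 ^ CARD('n)) * (v - u)\<^sup>2 / u"
    using u by (intro add_mono mult_left_mono mult_right_mono divide_right_mono weighted_err_le ae) auto
  finally show ?thesis by (simp add: \<gamma>_def \<gamma>'_def)
qed

section \<open>Consequences of the second-moment constraint\<close>

text \<open>This is the risk of the linear estimator that is optimal for a standard Gaussian signal;
  it involves only the second moment of \<open>X\<close>, as signal and noise are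
  uncorrelated.\<close>

lemma sq_err_le_linear:
  assumes \<gamma>: "\<gamma> > 0"
    and X2: "\<And>i. integrable M (\<lambda>\<omega>. (X \<omega> $ i)\<^sup>2)"
      "expectation (\<lambda>\<omega>. (norm (X \<omega>))\<^sup>2) \<le> real CARD('n)"
  shows "sq_err \<gamma> \<le> real CARD('n) / (1 + \<gamma>)"
proof -
  have XZ: "has_bochner_integral M (\<lambda>\<omega>. X \<omega> $ i * Z \<omega> $ i) 0" for i
  proof -
    have "indep_var borel ((\<lambda>v. v $ i) \<circ> X) borel ((\<lambda>v. v $ i) \<circ> Z)"
      by (rule indep_var_compose[OF indep_X_Z]) measurable
    moreover have "integrable M (\<lambda>\<omega>. X \<omega> $ i)"
      by (rule square_integrable_imp_integrable[OF _ X2(1)]) measurable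
    ultimately show ?thesis
      using indep_var_lebesgue_integral[of "\<lambda>\<omega>. X \<omega> $ i" "\<lambda>\<omega>. Z \<omega> $ i"]
        indep_var_integrable[of "\<lambda>\<omega>. X \<omega> $ i" "\<lambda>\<omega>. Z \<omega> $ i"] integrable_Z[of i]
      by (simp add: has_bochner_integral_iff expectation_Z comp_def)
  qed
  have XZ': "has_bochner_integral M (\<lambda>\<omega>. X \<omega> \<bullet> Z \<omega>) 0"
    using has_bochner_integral_sum[of UNIV M "\<lambda>i \<omega>. X \<omega> $ i * Z \<omega> $ i" "\<lambda>_. 0"] XZ
    by (simp add: inner_vec_def)
  have X: "integrable M (\<lambda>\<omega>. (norm (X \<omega>))\<^sup>2)"
    unfolding norm_power2_vec by (intro Bochner_Integration.integrable_sum X2(1))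
  define k where "k = sqrt \<gamma> / (1 + \<gamma>)"
  have est: "(norm (X \<omega> - k *\<^sub>R awgn X Z \<gamma> \<omega>))\<^sup>2
      = ((norm (X \<omega>))\<^sup>2 - 2 * sqrt \<gamma> * (X \<omega> \<bullet> Z \<omega>) + \<gamma> * (norm (Z \<omega>))\<^sup>2) / (1 + \<gamma>)\<^sup>2" for \<omega>
  proof -
    have "X \<omega> - k *\<^sub>R awgn X Z \<gamma> \<omega> = (1 / (1 + \<gamma>)) *\<^sub>R (X \<omega> - sqrt \<gamma> *\<^sub>R Z \<omega>)"
    proof -
      have "k * sqrt \<gamma> = 1 - 1 / (1 + \<gamma>)" "sqrt \<gamma> / (1 + \<gamma>) = k"
        using \<gamma> by (simp_all add: k_def field_simps)
      then show ?thesis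
        by (simp add: awgn_def scaleR_right_distrib scaleR_right_diff_distrib scaleR_left_diff_distrib)
    qed
    then have "(norm (X \<omega> - k *\<^sub>R awgn X Z \<gamma> \<omega>))\<^sup>2 = (norm (X \<omega> - sqrt \<gamma> *\<^sub>R Z \<omega>))\<^sup>2 / (1 + \<gamma>)\<^sup>2"
      by (simp add: power_divide)
    also have "(norm (X \<omega> - sqrt \<gamma> *\<^sub>R Z \<omega>))\<^sup>2
        = (norm (X \<omega>))\<^sup>2 - 2 * sqrt \<gamma> * (X \<omega> \<bullet> Z \<omega>) + \<gamma> * (norm (Z \<omega>))\<^sup>2"
      using \<gamma> by (simp add: power2_norm_eq_inner inner_diff inner_commute)
    finally show ?thesis .
  qed
  have int: "integrable M (\<lambda>\<omega>. (norm (X \<omega> - k *\<^sub>R awgn X Z \<gamma> \<omega>))\<^sup>2)"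
    unfolding est using X XZ' moment_norm2_Z by (simp add: has_bochner_integral_iff)
  have "ennreal (sq_err \<gamma>) \<le> (\<integral>\<^sup>+\<omega>. ennreal ((norm (X \<omega> - k *\<^sub>R awgn X Z \<gamma> \<omega>))\<^sup>2) \<partial>M)"
    by (rule sq_err_le_estimator[OF \<gamma>]) measurable
  also have "\<dots> = ennreal (expectation (\<lambda>\<omega>. (norm (X \<omega> - k *\<^sub>R awgn X Z \<gamma> \<omega>))\<^sup>2))"
    by (rule nn_integral_eq_integral[OF int]) auto
  finally have "sq_err \<gamma> \<le> expectation (\<lambda>\<omega>. (norm (X \<omega> - k *\<^sub>R awgn X Z \<gamma> \<omega>))\<^sup>2)"
    by (subst (asm) ennreal_le_iff) auto
  also have "\<dots> = (expectation (\<lambda>\<omega>. (norm (X \<omega>))\<^sup>2) + \<gamma> * real CARD('n)) / (1 + \<gamma>)\<^sup>2"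
    unfolding est using X XZ' moment_norm2_Z by (simp add: has_bochner_integral_iff)
  also have "\<dots> \<le> (real CARD('n) + \<gamma> * real CARD('n)) / (1 + \<gamma>)\<^sup>2"
    using X2(2) by (intro divide_right_mono add_right_mono) auto
  also have "\<dots> = real CARD('n) / (1 + \<gamma>)"
  proof -
    have "real CARD('n) + \<gamma> * real CARD('n) = real CARD('n) * (1 + \<gamma>)" "1 + \<gamma> \<noteq> 0"
      using \<gamma> by (simp_all add: algebra_simps)
    then show ?thesis by (simp add: power2_eq_square)
  qed
  finally show ?thesis .
qed

text \<open>The linear bound on the error, read through \<open>mean2_eq\<close>, bounds the second
  moment of \<open>m\<close> from below by \<open>\<mu> = n / (1 + \<gamma>)\<close>, and Jensen
  squares it. Of the resulting factor \<open>n\<^sup>2\<close> only n is kept.\<close>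

lemma mean4_ge:
  assumes u: "u > 0"
    and X2: "\<And>i. integrable M (\<lambda>\<omega>. (X \<omega> $ i)\<^sup>2)"
      "expectation (\<lambda>\<omega>. (norm (X \<omega>))\<^sup>2) \<le> real CARD('n)"
  shows "real CARD('n) * (u / (1 + u))\<^sup>2 \<le> expectation (\<lambda>\<omega>. ((norm (Z_mean (1 / u) \<omega>))\<^sup>2)\<^sup>2)"
proof -
  let ?c = "\<lambda>\<omega>. (norm (Z_mean (1 / u) \<omega>))\<^sup>2"
  define \<mu> where "\<mu> = real CARD('n) * (u / (1 + u))"
  have "expectation (\<lambda>\<omega>. (norm (Z_err (1 / u) \<omega>))\<^sup>2) = sq_err (1 / u) / u"
    using u by (simp add: sq_err_def)
  also have "\<dots> \<le> real CARD('n) / (1 + 1 / u) / u"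
    using u X2 by (intro divide_right_mono sq_err_le_linear) auto
  also have "\<dots> = real CARD('n) - \<mu>"
  proof -
    have "1 + 1 / u = (1 + u) / u" "u / (1 + u) = 1 - 1 / (1 + u)"
      using u by (simp_all add: field_simps)
    then show ?thesis using u by (simp add: \<mu>_def right_diff_distrib)
  qed
  finally have \<mu>: "\<mu> \<le> expectation ?c" unfolding mean2_eq by linarith
  \<comment> \<open>Jensen by hand: expanding around the lower bound \<open>\<mu>\<close> instead of
    the mean gives the estimate in terms of \<open>\<mu>\<close> directly.\<close>
  have "0 \<le> expectation (\<lambda>\<omega>. (?c \<omega> - \<mu>)\<^sup>2)" by simp
  also have "\<dots> = expectation (\<lambda>\<omega>. (?c \<omega>)\<^sup>2 + (\<mu>\<^sup>2 - 2 * \<mu> * ?c \<omega>))"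
    by (intro Bochner_Integration.integral_cong) (auto simp: power2_eq_square algebra_simps)
  also have "\<dots> = expectation (\<lambda>\<omega>. (?c \<omega>)\<^sup>2) + (\<mu>\<^sup>2 - 2 * \<mu> * expectation ?c)"
    using integrable_norm4_Z_mean[of "1 / u"] integrable_norm2_Z_mean[of "1 / u"]
    by (simp add: prob_space)
  also have "\<dots> \<le> expectation (\<lambda>\<omega>. (?c \<omega>)\<^sup>2) + (\<mu>\<^sup>2 - 2 * \<mu> * \<mu>)"
    using \<mu> u by (intro add_left_mono diff_left_mono mult_left_mono) (auto simp: \<mu>_def)
  finally have *: "\<mu>\<^sup>2 \<le> expectation (\<lambda>\<omega>. (?c \<omega>)\<^sup>2)" by (simp add: power2_eq_square[of \<mu>])
  have "real CARD('n) * (u / (1 + u))\<^sup>2 \<le> \<mu>\<^sup>2"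
  proof -
    have "1 \<le> real CARD('n)" by (simp add: Suc_leI)
    then have "real CARD('n) * 1 \<le> (real CARD('n))\<^sup>2"
      unfolding power2_eq_square by (intro mult_left_mono) auto
    then show ?thesis unfolding \<mu>_def power_mult_distrib by (intro mult_right_mono) auto
  qed
  from this * show ?thesis by (rule order_trans)
qed

section \<open>Summation over a subdivision and conclusion\<close>

text \<open>Common to both inequalities: \<open>w\<close> is a lower bound for \<open>E|m|^4\<close>
  and \<open>W\<close> takes the place of its integral over u. The one-step bound makes the
  increments of \<open>G\<close> quadratically small, so \<open>G\<close> decreases.\<close>

lemma sq_err_diff_le:
  assumes s: "0 < s" "s \<le> t"
    and w: "\<And>u. 0 < u \<Longrightarrow> w u \<le> expectation (\<lambda>\<omega>. ((norm (Z_mean (1 / u) \<omega>))\<^sup>2)\<^sup>2)"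
    and W: "\<And>u v. 0 < u \<Longrightarrow> u \<le> v \<Longrightarrow> W v - W u \<le> w u * (v - u) + B * (v - u)\<^sup>2"
  shows "sq_err (1 / t) - sq_err (1 / s)
    \<le> real CARD('n) * (real CARD('n) + 2) * (t - s) - (W t - W s)"
proof -
  define K where "K = real CARD('n) * (real CARD('n) + 2)"
  define C where "C = 64 * (8 * (real CARD('n) * (real CARD('n) + 2) + 3 * (real CARD('n))\<^sup>2) + 2 ^ CARD('n))"
  define G where "G = (\<lambda>u. sq_err (1 / u) + W u - K * u)"
  have "G t \<le> G s"
  \<comment> \<open>Step size \<open>s / 4\<close> ensures \<open>v - u \<le> u / 4\<close> for
    every \<open>u \<ge> s\<close>, and \<open>C / s\<close> dominates \<open>C / u\<close>.\<close>
  proof (rule le_of_quadratic_increments[where G = G and a = s and b = t and \<eta> = "s / 4" and C = "C / s + B"])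
    fix u v assume uv: "s \<le> u" "u \<le> v" "v \<le> t" "v - u \<le> s / 4"
    have pos: "0 < u" "v - u \<le> u / 4" using uv s by auto
    have "C \<ge> 0" by (simp add: C_def)
    have "sq_err (1 / v) - sq_err (1 / u)
        \<le> (v - u) * (K - expectation (\<lambda>\<omega>. ((norm (Z_mean (1 / u) \<omega>))\<^sup>2)\<^sup>2)) + C * (v - u)\<^sup>2 / u"
      unfolding K_def C_def using pos uv by (intro sq_err_increment_le) auto
    also have "\<dots> \<le> (v - u) * (K - w u) + C * (v - u)\<^sup>2 / s"
      using uv s pos \<open>C \<ge> 0\<close> w[OF pos(1)]
      by (intro add_mono mult_left_mono diff_left_mono divide_left_mono) auto
    finally show "G v - G u \<le> (C / s + B) * (v - u)\<^sup>2"
      using W[OF pos(1) uv(2)] by (simp add: G_def algebra_simps)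
  qed (use s in auto)
  then show ?thesis by (simp add: G_def K_def algebra_simps)
qed

text \<open>Both parts are \<open>sq_err_diff_le\<close> on the interval from
  \<open>1 / snr\<^sub>0\<close> to \<open>1 / snr\<close>, divided by n. Integrability of
  \<open>outer (X \<omega>)\<close> is demanded explicitly because a Bochner integral defaults to 0
  otherwise, and the trace bound would then hold for no reason.\<close>

lemma mmse_increment_le:
  assumes snr: "0 < snr" "snr \<le> snr\<^sub>0"
  shows "mmse M X Z snr \<le> mmse M X Z snr\<^sub>0 + (real CARD('n) + 2) * (1 / snr - 1 / snr\<^sub>0)" (is ?part1)
    and "integrable M (\<lambda>\<omega>. outer (X \<omega>)) \<Longrightarrow>
      trace (integral\<^sup>L M (\<lambda>\<omega>. outer (X \<omega>))) / real CARD('n) \<le> 1 \<Longrightarrow>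
      mmse M X Z snr \<le> mmse M X Z snr\<^sub>0 + (real CARD('n) + 2) * (1 / snr - 1 / snr\<^sub>0)
        - integral {snr..snr\<^sub>0} (\<lambda>\<gamma>. 1 / (\<gamma>\<^sup>2 * (1 + \<gamma>)\<^sup>2))"
      (is "_ \<Longrightarrow> _ \<Longrightarrow> ?part2")
proof -
  let ?n = "real CARD('n)"
  let ?\<Delta> = "integral {snr..snr\<^sub>0} (\<lambda>\<gamma>. 1 / (\<gamma>\<^sup>2 * (1 + \<gamma>)\<^sup>2))"
  have pos: "snr > 0" "snr\<^sub>0 > 0" and le: "1 / snr\<^sub>0 \<le> 1 / snr"
    using snr by (auto intro: divide_left_mono)
  have mmse_le: "mmse M X Z snr \<le> mmse M X Z snr\<^sub>0 + (?n + 2) * (1 / snr - 1 / snr\<^sub>0) - D"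
    if "sq_err snr - sq_err snr\<^sub>0 \<le> ?n * (?n + 2) * (1 / snr - 1 / snr\<^sub>0) - ?n * D" for D
  proof -
    have "sq_err snr \<le> sq_err snr\<^sub>0 + ?n * ((?n + 2) * (1 / snr - 1 / snr\<^sub>0) - D)"
      using that by (simp add: algebra_simps)
    then have "sq_err snr / ?n \<le> (sq_err snr\<^sub>0 + ?n * ((?n + 2) * (1 / snr - 1 / snr\<^sub>0) - D)) / ?n"
      by (intro divide_right_mono) auto
    also have "\<dots> = sq_err snr\<^sub>0 / ?n + ((?n + 2) * (1 / snr - 1 / snr\<^sub>0) - D)"
      by (simp add: add_divide_distrib)
    finally show ?thesis using pos by (simp add: mmse_eq_sq_err)
  qed
  have \<Delta>: "?\<Delta> = 2 * ln ((1 + snr\<^sub>0) / (1 + snr)) - 2 * ln (snr\<^sub>0 / snr)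
          + 1 / (1 + snr) - 1 / (1 + snr\<^sub>0) + 1 / snr - 1 / snr\<^sub>0"
    using has_integral_inverse_square_product[OF snr] by (rule integral_unique)
  have "sq_err (1 / (1 / snr)) - sq_err (1 / (1 / snr\<^sub>0))
      \<le> ?n * (?n + 2) * (1 / snr - 1 / snr\<^sub>0) - (0 - 0)"
    by (rule sq_err_diff_le[where w = "\<lambda>_. 0" and W = "\<lambda>_. 0" and B = 0]) (use pos le in auto)
  then show ?part1
    using mmse_le[of 0] by simp
  show ?part2
    if outer: "integrable M (\<lambda>\<omega>. outer (X \<omega>))"
      and tr: "trace (integral\<^sup>L M (\<lambda>\<omega>. outer (X \<omega>))) / ?n \<le> 1"
  proof (rule mmse_le)
    have bl: "bounded_linear (\<lambda>A :: real ^ 'n ^ 'n. A $ i $ i)" for i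
      by (intro bounded_linear_compose[OF bounded_linear_vec_nth bounded_linear_vec_nth])
    have nth: "integrable M (\<lambda>\<omega>. outer (X \<omega>) $ i $ i)"
      "integral\<^sup>L M (\<lambda>\<omega>. outer (X \<omega>)) $ i $ i = expectation (\<lambda>\<omega>. outer (X \<omega>) $ i $ i)" for i
      by (rule integrable_bounded_linear[OF bl outer], rule integral_bounded_linear[OF bl outer, symmetric])
    have X2: "integrable M (\<lambda>\<omega>. (X \<omega> $ i)\<^sup>2)" for i
      using nth(1)[of i] by (simp add: outer_nth power2_eq_square)
    have "expectation (\<lambda>\<omega>. (norm (X \<omega>))\<^sup>2) = (\<Sum>i\<in>UNIV. expectation (\<lambda>\<omega>. (X \<omega> $ i)\<^sup>2))"
      unfolding norm_power2_vec by (rule Bochner_Integration.integral_sum) (rule X2)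
    also have "\<dots> = trace (integral\<^sup>L M (\<lambda>\<omega>. outer (X \<omega>)))"
      unfolding trace_def nth(2) by (simp add: outer_nth power2_eq_square)
    also have "\<dots> \<le> ?n" using tr by (simp add: field_simps)
    finally have X2': "expectation (\<lambda>\<omega>. (norm (X \<omega>))\<^sup>2) \<le> ?n" .
    define W where "W = (\<lambda>u. ?n * (u - 2 * ln (1 + u) - 1 / (1 + u)))"
    have "sq_err (1 / (1 / snr)) - sq_err (1 / (1 / snr\<^sub>0))
        \<le> ?n * (?n + 2) * (1 / snr - 1 / snr\<^sub>0) - (W (1 / snr) - W (1 / snr\<^sub>0))"
    proof (rule sq_err_diff_le[where w = "\<lambda>u. ?n * (u / (1 + u))\<^sup>2" and B = "2 * ?n"])
      show "?n * (u / (1 + u))\<^sup>2 \<le> expectation (\<lambda>\<omega>. ((norm (Z_mean (1 / u) \<omega>))\<^sup>2)\<^sup>2)" if "0 < u" for u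
        by (rule mean4_ge[OF that X2 X2'])
      show "W v - W u \<le> ?n * (u / (1 + u))\<^sup>2 * (v - u) + 2 * ?n * (v - u)\<^sup>2" if "0 < u" "u \<le> v" for u v
        using mult_left_mono[OF odds_square_antiderivative_increment[OF that], of ?n]
        by (simp add: W_def algebra_simps)
    qed (use pos le in auto)
    \<comment> \<open>The substitution \<open>u = 1 / \<gamma>\<close> carries the integral of
      \<open>(u / (1 + u))\<^sup>2\<close> to that of
      \<open>1 / (\<gamma>\<^sup>2 * (1 + \<gamma>)\<^sup>2)\<close>; it is verified on the closed
      forms, where the constants -1 cancel.\<close>
    moreover have "W (1 / snr) - W (1 / snr\<^sub>0) = ?n * ?\<Delta>"
    proof -
      have W: "W (1 / x) = ?n * (1 / x - 2 * ln (1 + x) + 2 * ln x - 1 + 1 / (1 + x))" if "x > 0" for x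
      proof -
        have "1 + 1 / x = (1 + x) / x" using that by (simp add: field_simps)
        then have "ln (1 + 1 / x) = ln (1 + x) - ln x" "1 / (1 + 1 / x) = 1 - 1 / (1 + x)"
          using that by (simp_all add: ln_div field_simps)
        then show ?thesis by (simp add: W_def)
      qed
      show ?thesis unfolding \<Delta> W[OF pos(1)] W[OF pos(2)]
        using pos by (simp add: ln_div algebra_simps)
    qed
    ultimately show "sq_err snr - sq_err snr\<^sub>0 \<le> ?n * (?n + 2) * (1 / snr - 1 / snr\<^sub>0) - ?n * ?\<Delta>"
      by simp
  qed
qed

end

theorem theorem1:
  fixes M :: "'a measure"
    and X Z :: "'a \<Rightarrow> real ^ 'n"
    and snr snr\<^sub>0 \<beta> :: real
  assumes "prob_space M"
    and "X \<in> borel_measurable M"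
    and "distributed M lborel Z (\<lambda>z. ennreal (std_gaussian_density z))"
    and "prob_space.indep_var M borel X borel Z"
    and "0 < snr" and "snr \<le> snr\<^sub>0"
    and "0 \<le> \<beta>" and "\<beta> \<le> 1"
    and "mmse M X Z snr\<^sub>0 = \<beta> / (1 + \<beta> * snr\<^sub>0)"
  shows "mmse M X Z snr
           \<le> mmse M X Z snr\<^sub>0 + (real CARD('n) + 2) * (1 / snr - 1 / snr\<^sub>0)
    \<and> (integrable M (\<lambda>\<omega>. outer (X \<omega>))
         \<and> trace (integral\<^sup>L M (\<lambda>\<omega>. outer (X \<omega>))) / real CARD('n) \<le> 1
       \<longrightarrow> mmse M X Z snr
           \<le> mmse M X Z snr\<^sub>0 + (real CARD('n) + 2) * (1 / snr - 1 / snr\<^sub>0)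
             - integral {snr..snr\<^sub>0} (\<lambda>\<gamma>. 1 / (\<gamma>\<^sup>2 * (1 + \<gamma>)\<^sup>2)))
    \<and> integral {snr..snr\<^sub>0} (\<lambda>\<gamma>. 1 / (\<gamma>\<^sup>2 * (1 + \<gamma>)\<^sup>2))
        = 2 * ln ((1 + snr\<^sub>0) / (1 + snr)) - 2 * ln (snr\<^sub>0 / snr)
          + 1 / (1 + snr) - 1 / (1 + snr\<^sub>0) + 1 / snr - 1 / snr\<^sub>0"
proof -
  have channel: "gaussian_channel M X Z"
    using assms(1-4) by (simp add: gaussian_channel_def gaussian_channel_axioms_def)
  show ?thesis
    using gaussian_channel.mmse_increment_le[OF channel assms(5,6)]
      has_integral_inverse_square_product[OF assms(5,6), THEN integral_unique]
    by simp
qed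

end
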